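(* Let $K$ be a field, $E$ a weighted graph, $(F,\phi)$ a representation graph for $E$ with $F$ nonempty, and $V_F$ the right $L_K(E)$-module defined by $(F,\phi)$. Then the following are equivalent. (i) The $L_K(E)$-module $V_F$ is simple. (ii) $F$ is connected, and for any $x\in V_F\setminus\{0\}$ there is an $a\in L_K(E)$ such that $x\cdot a\in F^0$. (iii) $F$ is connected, and for any $x\in V_F\setminus\{0\}$ there are $k\in K$ and $p\in \mathrm{Path}(\hat E_d)$ such that $x\cdot kp\in F^0$. (iv) $(F,\phi)$ is an irreducible representation graph for $E$.
   Context: Graphs: a directed graph $E=(E^0,E^1,r,s)$ consists of sets $E^0$ (vertices), $E^1$ (edges) and maps $r,s:E^1\to E^0$ (range, source). All graphs are row-finite ($s^{-1}(v)$ is finite for every vertex $v$). A weighted graph is such a graph $E$ with a map $w:E^1\to\mathbb N=\{1,2,\dots\}$. For $v\in E^0$, $w(v)=\max\{w(e)\mid e\in s^{-1}(v)\}$, and $w(v)=0$ if $v$ is a sink. The associated directed graph $\hat E$ has $\hat E^0=E^0$, $\hat E^1=\{e_1,\dots,e_{w(e)}\mid e\in E^1\}$, $\hat s(e_i)=s(e)$, $\hat r(e_i)=r(e)$; the tag of $e_i$ is $\mathrm{tag}(e_i)=i$ and its structure edge is $\mathrm{st}(e_i)=e$. Representation graphs: a representation graph of $E$ is a pair $(F,\phi)$, $F$ a directed graph and $\phi=(\phi^0,\phi^1):F\to\hat E$ a homomorphism of directed graphs, such that (1) for any $v\in F^0$ and $1\le i\le w(\phi^0(v))$ there is precisely one $f\in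 s_F^{-1}(v)$ with $\mathrm{tag}(\phi^1(f))=i$; (2) for any $v\in F^0$ and $e\in r^{-1}(\phi^0(v))$ there is precisely one $f\in r_F^{-1}(v)$ with $\mathrm{st}(\phi^1(f))=e$. Paths: the double graph $G_d$ of a directed graph $G$ is obtained by adding to $G$ a reversed edge $g^*$ for each edge $g$. $\mathrm{Path}(G)$ is the set of finite paths of $G$ (vertices are paths of length $0$); ${}_u\mathrm{Path}(G)$ is the set of those starting at $u$, and ${}_u\mathrm{Path}_v(G)$ of those starting at $u$ and ending at $v$. $\phi$ induces a map $\phi:\mathrm{Path}(F_d)\to\mathrm{Path}(\hat E_d)$. $F$ is connected if ${}_u\mathrm{Path}_v(F_d)\ne\emptyset$ for all $u,v\in F^0$. $(F,\phi)$ is irreducible if $F$ is connected and $\phi({}_u\mathrm{Path}(F_d))\ne\phi({}_v\mathrm{Path}(F_d))$ for any $u\ne v$ in $F^0$ (equivalently, the same condition with paths ending, instead of starting, at $u$ and $v$). Algebra: $L_K(E)$ is the (associative, not necessarily unital) $K$-algebra generated by $\{v,e_i,e_i^*\mid v\in E^0,e\in E^1,1\le i\le w(e)\}$ subject to: $uv=\delta_{uv}u$ for $u,v\in E^0$; $s(e)e_i=e_i=e_ir(e)$, $r(e)e_i^*=e_i^*=e_i^*s(e)$; $\sum_{1\le i\le w(v)}e_i^*f_i=\delta_{ef}r(e)$ for $v\in E^0$, $e,f\in s^{-1}(v)$; $\sum_{e\in s^{-1}(v)}e_ie_j^*=\delta_{ij}v$ for $v\in E^0$, $1\le i,j\le w(v)$;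 in the last two, $e_i=e_i^*=0$ if $i>w(e)$. A path in $\hat E_d$ is regarded as a monomial of $L_K(E)$. Module: $V_F$ is the $K$-vector space with basis $F^0$ and right $L_K(E)$-action determined, for $v\in F^0$, by: $v\cdot u=v$ if $\phi^0(v)=u$ and $0$ otherwise ($u\in E^0$); $v\cdot e_i=r_F(f)$ if there is $f\in s_F^{-1}(v)$ with $\phi^1(f)=e_i$, and $0$ otherwise; $v\cdot e_i^*=s_F(f)$ if there is $f\in r_F^{-1}(v)$ with $\phi^1(f)=e_i$, and $0$ otherwise. *)

theory Defs
  imports "Graph_Theory.Arc_Walk" "HOL-Library.Poly_Mapping"
begin

section \<open>Weighted graphs and representation graphs\<close>

text \<open>Directed graphs are the records of the AFP entry \<open>Graph_Theory\<close>; the source map is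
  \<^const>\<open>tail\<close> and the range map is \<^const>\<open>head\<close>. A graph has no finiteness restriction other
  than row-finiteness.\<close>

locale row_finite_digraph = wf_digraph G for G :: "('a, 'b) pre_digraph" +
  assumes row_finite: "v \<in> verts G \<Longrightarrow> finite (out_arcs G v)"

locale weighted_graph = row_finite_digraph E for E :: "('v, 'e) pre_digraph" +
  fixes w :: "'e \<Rightarrow> nat"
  assumes weight_pos: "e \<in> arcs E \<Longrightarrow> 1 \<le> w e"

definition vertex_weight :: "('v, 'e) pre_digraph \<Rightarrow> ('e \<Rightarrow> nat) \<Rightarrow> 'v \<Rightarrow> nat" where
  "vertex_weight E w v = (if out_arcs E v = {} then 0 else Max (w ` out_arcs E v))"

text \<open>The arc \<open>e\<^sub>i\<close> of the associated directed graph is the pair \<open>(e, i)\<close>.\<close>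

definition hat_graph :: "('v, 'e) pre_digraph \<Rightarrow> ('e \<Rightarrow> nat) \<Rightarrow> ('v, 'e \<times> nat) pre_digraph" where
  "hat_graph E w =
     \<lparr> verts = verts E,
       arcs = {(e, i). e \<in> arcs E \<and> 1 \<le> i \<and> i \<le> w e},
       tail = (\<lambda>(e, i). tail E e),
       head = (\<lambda>(e, i). head E e) \<rparr>"

abbreviation st :: "'e \<times> nat \<Rightarrow> 'e" where "st \<equiv> fst"
abbreviation tag :: "'e \<times> nat \<Rightarrow> nat" where "tag \<equiv> snd"

definition graph_hom ::
  "('a, 'b) pre_digraph \<Rightarrow> ('c, 'd) pre_digraph \<Rightarrow> ('a \<Rightarrow> 'c) \<Rightarrow> ('b \<Rightarrow> 'd) \<Rightarrow> bool" where
  "graph_hom G H \<phi>0 \<phi>1 \<longleftrightarrow>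
     (\<forall>v\<in>verts G. \<phi>0 v \<in> verts H) \<and>
     (\<forall>f\<in>arcs G. \<phi>1 f \<in> arcs H \<and>
        tail H (\<phi>1 f) = \<phi>0 (tail G f) \<and> head H (\<phi>1 f) = \<phi>0 (head G f))"

locale representation_graph = weighted_graph E w + F: row_finite_digraph F
  for E :: "('v, 'e) pre_digraph" and w :: "'e \<Rightarrow> nat" and F :: "('a, 'b) pre_digraph" +
  fixes \<phi>0 :: "'a \<Rightarrow> 'v" and \<phi>1 :: "'b \<Rightarrow> 'e \<times> nat"
  assumes hom: "graph_hom F (hat_graph E w) \<phi>0 \<phi>1"
    and unique_tag: "\<lbrakk> v \<in> verts F; 1 \<le> i; i \<le> vertex_weight E w (\<phi>0 v) \<rbrakk>
          \<Longrightarrow> \<exists>!f. f \<in> out_arcs F v \<and> tag (\<phi>1 f) = i"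
    and unique_st: "\<lbrakk> v \<in> verts F; e \<in> in_arcs E (\<phi>0 v) \<rbrakk>
          \<Longrightarrow> \<exists>!f. f \<in> in_arcs F v \<and> st (\<phi>1 f) = e"


section \<open>Double graphs and paths\<close>

text \<open>\<open>Rev g\<close> is the added reversed arc \<open>g\<^sup>*\<close>.\<close>

datatype 'b darc = Fwd 'b | Rev 'b

definition double_graph :: "('a, 'b) pre_digraph \<Rightarrow> ('a, 'b darc) pre_digraph" where
  "double_graph G =
     \<lparr> verts = verts G,
       arcs = Fwd ` arcs G \<union> Rev ` arcs G,
       tail = case_darc (tail G) (head G),
       head = case_darc (head G) (tail G) \<rparr>"

text \<open>A path is its start vertex together with its list of arcs, so that the paths of length zero
  are the vertices.\<close>

definition paths_between :: "('a, 'b) pre_digraph \<Rightarrow> 'a \<Rightarrow> 'a \<Rightarrow> ('a \<times> 'b list) set" where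
  "paths_between G u v = {(u, es) |es. pre_digraph.awalk G u es v}"

definition paths_from :: "('a, 'b) pre_digraph \<Rightarrow> 'a \<Rightarrow> ('a \<times> 'b list) set" where
  "paths_from G u = (\<Union>v\<in>verts G. paths_between G u v)"

definition paths :: "('a, 'b) pre_digraph \<Rightarrow> ('a \<times> 'b list) set" where
  "paths G = (\<Union>u\<in>verts G. paths_from G u)"

definition path_map ::
  "('a \<Rightarrow> 'c) \<Rightarrow> ('b \<Rightarrow> 'd) \<Rightarrow> 'a \<times> 'b darc list \<Rightarrow> 'c \<times> 'd darc list" where
  "path_map \<phi>0 \<phi>1 = (\<lambda>(u, es). (\<phi>0 u, map (map_darc \<phi>1) es))"

definition connected_graph :: "('a, 'b) pre_digraph \<Rightarrow> bool" where
  "connected_graph F \<longleftrightarrow>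
     (\<forall>u\<in>verts F. \<forall>v\<in>verts F. paths_between (double_graph F) u v \<noteq> {})"

definition irreducible_representation_graph ::
  "('v, 'e) pre_digraph \<Rightarrow> ('e \<Rightarrow> nat) \<Rightarrow> ('a, 'b) pre_digraph \<Rightarrow> ('a \<Rightarrow> 'v) \<Rightarrow>
     ('b \<Rightarrow> 'e \<times> nat) \<Rightarrow> bool" where
  "irreducible_representation_graph E w F \<phi>0 \<phi>1 \<longleftrightarrow>
     representation_graph E w F \<phi>0 \<phi>1 \<and> connected_graph F \<and>
     (\<forall>u\<in>verts F. \<forall>v\<in>verts F. u \<noteq> v \<longrightarrow>
        path_map \<phi>0 \<phi>1 ` paths_from (double_graph F) u \<noteq>
        path_map \<phi>0 \<phi>1 ` paths_from (double_graph F) v)"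


section \<open>Finitely supported functions as vector spaces\<close>

definition pm_scale :: "'k::field \<Rightarrow> ('a \<Rightarrow>\<^sub>0 'k) \<Rightarrow> ('a \<Rightarrow>\<^sub>0 'k)" where
  "pm_scale c x = Poly_Mapping.map ((*) c) x"

definition linear_ext :: "('a \<Rightarrow> ('b \<Rightarrow>\<^sub>0 'k::field)) \<Rightarrow> ('a \<Rightarrow>\<^sub>0 'k) \<Rightarrow> ('b \<Rightarrow>\<^sub>0 'k)" where
  "linear_ext f x = (\<Sum>v\<in>Poly_Mapping.keys x. pm_scale (Poly_Mapping.lookup x v) (f v))"

lemma lookup_pm_scale [simp]:
  "Poly_Mapping.lookup (pm_scale c x) v = c * Poly_Mapping.lookup x v"
  by (simp add: pm_scale_def Poly_Mapping.map.rep_eq when_def)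

global_interpretation pm: vector_space pm_scale
  by unfold_locales (auto intro!: poly_mapping_eqI simp: lookup_add algebra_simps)

lemma pm_scale_single [simp]:
  "pm_scale c (Poly_Mapping.single v d) = Poly_Mapping.single v (c * d)"
  by (rule poly_mapping_eqI) (simp add: lookup_single when_def)

lemma linear_ext_superset:
  assumes "finite S" "Poly_Mapping.keys x \<subseteq> S"
  shows "linear_ext f x = (\<Sum>v\<in>S. pm_scale (Poly_Mapping.lookup x v) (f v))"
  unfolding linear_ext_def
  by (rule sum.mono_neutral_left) (use assms in \<open>auto simp: in_keys_iff\<close>)

lemma linear_ext_add: "linear_ext f (x + y) = linear_ext f x + linear_ext f y"
proof -
  let ?S = "Poly_Mapping.keys x \<union> Poly_Mapping.keys y"
  have "Poly_Mapping.keys (x + y) \<subseteq> ?S" by (rule Poly_Mapping.keys_add)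
  then show ?thesis
    by (simp add: linear_ext_superset[of ?S] lookup_add pm.scale_left_distrib sum.distrib)
qed

lemma linear_ext_scale: "linear_ext f (pm_scale c x) = pm_scale c (linear_ext f x)"
proof -
  have "Poly_Mapping.keys (pm_scale c x) \<subseteq> Poly_Mapping.keys x" by (auto simp: in_keys_iff)
  then show ?thesis
    by (simp add: linear_ext_superset[of "Poly_Mapping.keys x"] pm.scale_sum_right)
qed

lemma linear_ext_single [simp]: "linear_ext f (Poly_Mapping.single v c) = pm_scale c (f v)"
  by (simp add: linear_ext_superset[of "{v}"])

lemma linear_ext_zero [simp]: "linear_ext f 0 = 0"
  by (simp add: linear_ext_def)

lemma poly_mapping_induct_single:
  assumes "P 0" and "\<And>u c. P (Poly_Mapping.single u c)" and "\<And>p q. P p \<Longrightarrow> P q \<Longrightarrow> P (p + q)"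
  shows "P (p :: 'a \<Rightarrow>\<^sub>0 'k::ab_group_add)"
proof -
  have "P (\<Sum>u\<in>S. Poly_Mapping.single u (Poly_Mapping.lookup p u))" if "finite S" for S
    using that by (induction S) (auto intro: assms)
  moreover have "p = (\<Sum>u\<in>Poly_Mapping.keys p. Poly_Mapping.single u (Poly_Mapping.lookup p u))"
    by (rule poly_mapping_eqI)
      (auto simp: lookup_sum lookup_single when_def sum.delta' in_keys_iff)
  ultimately show ?thesis by (metis finite_keys)
qed


section \<open>Algebras and modules over algebras that need not be unital\<close>

record ('k, 'a) nualg =
  carr :: "'a set"
  nzero :: 'a
  nadd :: "'a \<Rightarrow> 'a \<Rightarrow> 'a"
  nmult :: "'a \<Rightarrow> 'a \<Rightarrow> 'a"
  nscale :: "'k \<Rightarrow> 'a \<Rightarrow> 'a"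

locale nonunital_algebra =
  fixes A :: "('k::field, 'a) nualg"
  assumes zero_closed: "nzero A \<in> carr A"
    and add_closed: "\<lbrakk> a \<in> carr A; b \<in> carr A \<rbrakk> \<Longrightarrow> nadd A a b \<in> carr A"
    and mult_closed: "\<lbrakk> a \<in> carr A; b \<in> carr A \<rbrakk> \<Longrightarrow> nmult A a b \<in> carr A"
    and scale_closed: "a \<in> carr A \<Longrightarrow> nscale A k a \<in> carr A"
    and add_assoc: "\<lbrakk> a \<in> carr A; b \<in> carr A; c \<in> carr A \<rbrakk> \<Longrightarrow>
          nadd A (nadd A a b) c = nadd A a (nadd A b c)"
    and add_comm: "\<lbrakk> a \<in> carr A; b \<in> carr A \<rbrakk> \<Longrightarrow> nadd A a b = nadd A b a"
    and add_zero: "a \<in> carr A \<Longrightarrow> nadd A (nzero A) a = a"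
    and add_inverse: "a \<in> carr A \<Longrightarrow> \<exists>b\<in>carr A. nadd A b a = nzero A"
    and mult_assoc: "\<lbrakk> a \<in> carr A; b \<in> carr A; c \<in> carr A \<rbrakk> \<Longrightarrow>
          nmult A (nmult A a b) c = nmult A a (nmult A b c)"
    and distrib_right: "\<lbrakk> a \<in> carr A; b \<in> carr A; c \<in> carr A \<rbrakk> \<Longrightarrow>
          nmult A (nadd A a b) c = nadd A (nmult A a c) (nmult A b c)"
    and distrib_left: "\<lbrakk> a \<in> carr A; b \<in> carr A; c \<in> carr A \<rbrakk> \<Longrightarrow>
          nmult A a (nadd A b c) = nadd A (nmult A a b) (nmult A a c)"
    and scale_one: "a \<in> carr A \<Longrightarrow> nscale A 1 a = a"
    and scale_scale: "a \<in> carr A \<Longrightarrow> nscale A k (nscale A l a) = nscale A (k * l) a"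
    and scale_add_left: "a \<in> carr A \<Longrightarrow> nscale A (k + l) a = nadd A (nscale A k a) (nscale A l a)"
    and scale_add_right: "\<lbrakk> a \<in> carr A; b \<in> carr A \<rbrakk> \<Longrightarrow>
          nscale A k (nadd A a b) = nadd A (nscale A k a) (nscale A k b)"
    and scale_mult_left: "\<lbrakk> a \<in> carr A; b \<in> carr A \<rbrakk> \<Longrightarrow>
          nmult A (nscale A k a) b = nscale A k (nmult A a b)"
    and scale_mult_right: "\<lbrakk> a \<in> carr A; b \<in> carr A \<rbrakk> \<Longrightarrow>
          nmult A a (nscale A k b) = nscale A k (nmult A a b)"

definition additive_subgroup :: "'m::ab_group_add set \<Rightarrow> bool" where
  "additive_subgroup U \<longleftrightarrow> 0 \<in> U \<and> (\<forall>x\<in>U. \<forall>y\<in>U. x + y \<in> U) \<and> (\<forall>x\<in>U. - x \<in> U)"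

locale right_module = nonunital_algebra A for A :: "('k::field, 'a) nualg" +
  fixes V :: "'m::ab_group_add set" and act :: "'m \<Rightarrow> 'a \<Rightarrow> 'm"
  assumes subgroup: "additive_subgroup V"
    and act_closed: "\<lbrakk> x \<in> V; a \<in> carr A \<rbrakk> \<Longrightarrow> act x a \<in> V"
    and act_add_left: "\<lbrakk> x \<in> V; y \<in> V; a \<in> carr A \<rbrakk> \<Longrightarrow> act (x + y) a = act x a + act y a"
    and act_add_right: "\<lbrakk> x \<in> V; a \<in> carr A; b \<in> carr A \<rbrakk> \<Longrightarrow>
          act x (nadd A a b) = act x a + act x b"
    and act_mult: "\<lbrakk> x \<in> V; a \<in> carr A; b \<in> carr A \<rbrakk> \<Longrightarrow>
          act x (nmult A a b) = act (act x a) b"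

definition right_submodule ::
  "('k::field, 'a) nualg \<Rightarrow> 'm::ab_group_add set \<Rightarrow> ('m \<Rightarrow> 'a \<Rightarrow> 'm) \<Rightarrow> 'm set \<Rightarrow> bool" where
  "right_submodule A V act U \<longleftrightarrow>
     additive_subgroup U \<and> U \<subseteq> V \<and> (\<forall>x\<in>U. \<forall>a\<in>carr A. act x a \<in> U)"

text \<open>As the algebra need not be unital, a simple module is required not to be annihilated by it;
  in particular it is nonzero.\<close>

definition simple_right_module ::
  "('k::field, 'a) nualg \<Rightarrow> 'm::ab_group_add set \<Rightarrow> ('m \<Rightarrow> 'a \<Rightarrow> 'm) \<Rightarrow> bool" where
  "simple_right_module A V act \<longleftrightarrow>
     right_module A V act \<and>
     (\<exists>x\<in>V. \<exists>a\<in>carr A. act x a \<noteq> 0) \<and>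
     (\<forall>U. right_submodule A V act U \<longrightarrow> U = {0} \<or> U = V)"


section \<open>Weighted Leavitt path algebras\<close>

text \<open>Words are written additively, because the convolution product of \<^typ>\<open>'a \<Rightarrow>\<^sub>0 'k\<close> is defined
  for additive monoids of exponents; finitely supported functions on words then form the free
  unital algebra.\<close>

datatype 'g fword = FWord (letters: "'g list")

instantiation fword :: (type) monoid_add
begin

definition "0 = FWord []"
definition "u + v = FWord (letters u @ letters v)"

instance
  by standard (auto simp: zero_fword_def plus_fword_def)

end

text \<open>\<open>Arc (Fwd (e, i))\<close> stands for \<open>e\<^sub>i\<close> and \<open>Arc (Rev (e, i))\<close> for \<open>e\<^sub>i\<^sup>*\<close>.\<close>

datatype ('v, 'e) gen = Vert 'v | Arc "('e \<times> nat) darc"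

type_synonym ('v, 'e, 'k) free_elem = "('v, 'e) gen fword \<Rightarrow>\<^sub>0 'k"
type_synonym ('v, 'e, 'k) wlpa_elem = "('v, 'e, 'k) free_elem set"

definition gens :: "('v, 'e) pre_digraph \<Rightarrow> ('e \<Rightarrow> nat) \<Rightarrow> ('v, 'e) gen set" where
  "gens E w = Vert ` verts E \<union> Arc ` arcs (double_graph (hat_graph E w))"

text \<open>The free algebra without unit: no constant terms.\<close>

definition free_algebra :: "'g set \<Rightarrow> ('g fword \<Rightarrow>\<^sub>0 'k::field) set" where
  "free_algebra X = {p. \<forall>u\<in>Poly_Mapping.keys p. letters u \<noteq> [] \<and> set (letters u) \<subseteq> X}"

definition gen_elem :: "'g \<Rightarrow> ('g fword \<Rightarrow>\<^sub>0 'k::field)" where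
  "gen_elem g = Poly_Mapping.single (FWord [g]) 1"

abbreviation vert_elem :: "'v \<Rightarrow> ('v, 'e, 'k::field) free_elem" where
  "vert_elem v \<equiv> gen_elem (Vert v)"

definition arc_elem :: "('e \<Rightarrow> nat) \<Rightarrow> 'e \<Rightarrow> nat \<Rightarrow> ('v, 'e, 'k::field) free_elem" where
  "arc_elem w e i = (if i \<le> w e then gen_elem (Arc (Fwd (e, i))) else 0)"

definition ghost_elem :: "('e \<Rightarrow> nat) \<Rightarrow> 'e \<Rightarrow> nat \<Rightarrow> ('v, 'e, 'k::field) free_elem" where
  "ghost_elem w e i = (if i \<le> w e then gen_elem (Arc (Rev (e, i))) else 0)"

text \<open>Each relation \<open>l = r\<close> is recorded as \<open>l - r\<close>.\<close>

inductive_set wlpa_relations ::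
  "('v, 'e) pre_digraph \<Rightarrow> ('e \<Rightarrow> nat) \<Rightarrow> ('v, 'e, 'k::field) free_elem set"
  for E w where
  vert_mult: "\<lbrakk> u \<in> verts E; v \<in> verts E \<rbrakk> \<Longrightarrow>
    vert_elem u * vert_elem v - (if u = v then vert_elem u else 0) \<in> wlpa_relations E w"
| tail_arc: "\<lbrakk> e \<in> arcs E; 1 \<le> i; i \<le> w e \<rbrakk> \<Longrightarrow>
    vert_elem (tail E e) * arc_elem w e i - arc_elem w e i \<in> wlpa_relations E w"
| arc_head: "\<lbrakk> e \<in> arcs E; 1 \<le> i; i \<le> w e \<rbrakk> \<Longrightarrow>
    arc_elem w e i * vert_elem (head E e) - arc_elem w e i \<in> wlpa_relations E w"
| head_ghost: "\<lbrakk> e \<in> arcs E; 1 \<le> i; i \<le> w e \<rbrakk> \<Longrightarrow>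
    vert_elem (head E e) * ghost_elem w e i - ghost_elem w e i \<in> wlpa_relations E w"
| ghost_tail: "\<lbrakk> e \<in> arcs E; 1 \<le> i; i \<le> w e \<rbrakk> \<Longrightarrow>
    ghost_elem w e i * vert_elem (tail E e) - ghost_elem w e i \<in> wlpa_relations E w"
| ghost_arc: "\<lbrakk> v \<in> verts E; e \<in> out_arcs E v; f \<in> out_arcs E v \<rbrakk> \<Longrightarrow>
    (\<Sum>i = 1..vertex_weight E w v. ghost_elem w e i * arc_elem w f i)
      - (if e = f then vert_elem (head E e) else 0) \<in> wlpa_relations E w"
| arc_ghost: "\<lbrakk> v \<in> verts E; 1 \<le> i; i \<le> vertex_weight E w v;
                1 \<le> j; j \<le> vertex_weight E w v \<rbrakk> \<Longrightarrow>
    (\<Sum>e\<in>out_arcs E v. arc_elem w e i * ghost_elem w e j)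
      - (if i = j then vert_elem v else 0) \<in> wlpa_relations E w"

inductive_set wlpa_ideal ::
  "('v, 'e) pre_digraph \<Rightarrow> ('e \<Rightarrow> nat) \<Rightarrow> ('v, 'e, 'k::field) free_elem set"
  for E w where
  zero: "0 \<in> wlpa_ideal E w"
| relation: "r \<in> wlpa_relations E w \<Longrightarrow> r \<in> wlpa_ideal E w"
| add: "\<lbrakk> p \<in> wlpa_ideal E w; q \<in> wlpa_ideal E w \<rbrakk> \<Longrightarrow> p + q \<in> wlpa_ideal E w"
| scale: "p \<in> wlpa_ideal E w \<Longrightarrow> pm_scale c p \<in> wlpa_ideal E w"
| mult_left: "\<lbrakk> p \<in> wlpa_ideal E w; a \<in> free_algebra (gens E w) \<rbrakk> \<Longrightarrow> a * p \<in> wlpa_ideal E w"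
| mult_right: "\<lbrakk> p \<in> wlpa_ideal E w; a \<in> free_algebra (gens E w) \<rbrakk> \<Longrightarrow> p * a \<in> wlpa_ideal E w"

definition wlpa_cong ::
  "('v, 'e) pre_digraph \<Rightarrow> ('e \<Rightarrow> nat) \<Rightarrow> ('v, 'e, 'k::field) free_elem rel" where
  "wlpa_cong E w = {(p, q). p \<in> free_algebra (gens E w) \<and> q \<in> free_algebra (gens E w) \<and>
                            p - q \<in> wlpa_ideal E w}"

abbreviation wlpa_class ::
  "('v, 'e) pre_digraph \<Rightarrow> ('e \<Rightarrow> nat) \<Rightarrow> ('v, 'e, 'k::field) free_elem \<Rightarrow> ('v, 'e, 'k) wlpa_elem"
  where "wlpa_class E w p \<equiv> wlpa_cong E w `` {p}"

definition wlpa ::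
  "('v, 'e) pre_digraph \<Rightarrow> ('e \<Rightarrow> nat) \<Rightarrow> ('k::field, ('v, 'e, 'k) wlpa_elem) nualg" where
  "wlpa E w =
     \<lparr> carr = free_algebra (gens E w) // wlpa_cong E w,
       nzero = wlpa_class E w 0,
       nadd = (\<lambda>P Q. \<Union>p\<in>P. \<Union>q\<in>Q. wlpa_class E w (p + q)),
       nmult = (\<lambda>P Q. \<Union>p\<in>P. \<Union>q\<in>Q. wlpa_class E w (p * q)),
       nscale = (\<lambda>c P. \<Union>p\<in>P. wlpa_class E w (pm_scale c p)) \<rparr>"

fun path_word :: "'v \<times> ('e \<times> nat) darc list \<Rightarrow> ('v, 'e) gen list" where
  "path_word (u, []) = [Vert u]"
| "path_word (u, es) = map Arc es"

definition path_monomial ::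
  "('v, 'e) pre_digraph \<Rightarrow> ('e \<Rightarrow> nat) \<Rightarrow> 'v \<times> ('e \<times> nat) darc list \<Rightarrow>
     ('v, 'e, 'k::field) wlpa_elem" where
  "path_monomial E w p = wlpa_class E w (Poly_Mapping.single (FWord (path_word p)) 1)"


section \<open>The module of a representation graph\<close>

definition rep_module :: "('a, 'b) pre_digraph \<Rightarrow> ('a \<Rightarrow>\<^sub>0 'k::field) set" where
  "rep_module F = {x. Poly_Mapping.keys x \<subseteq> verts F}"

abbreviation basis_elem :: "'a \<Rightarrow> ('a \<Rightarrow>\<^sub>0 'k::field)" where
  "basis_elem v \<equiv> Poly_Mapping.single v 1"

fun basis_act ::
  "('a, 'b) pre_digraph \<Rightarrow> ('a \<Rightarrow> 'v) \<Rightarrow> ('b \<Rightarrow> 'e \<times> nat) \<Rightarrow> ('v, 'e) gen \<Rightarrow> 'a \<Rightarrow>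
     ('a \<Rightarrow>\<^sub>0 'k::field)" where
  "basis_act F \<phi>0 \<phi>1 (Vert u) v = (if \<phi>0 v = u then basis_elem v else 0)"
| "basis_act F \<phi>0 \<phi>1 (Arc (Fwd a)) v =
     (if \<exists>f. f \<in> out_arcs F v \<and> \<phi>1 f = a
      then basis_elem (head F (THE f. f \<in> out_arcs F v \<and> \<phi>1 f = a)) else 0)"
| "basis_act F \<phi>0 \<phi>1 (Arc (Rev a)) v =
     (if \<exists>f. f \<in> in_arcs F v \<and> \<phi>1 f = a
      then basis_elem (tail F (THE f. f \<in> in_arcs F v \<and> \<phi>1 f = a)) else 0)"

definition word_act ::
  "('a, 'b) pre_digraph \<Rightarrow> ('a \<Rightarrow> 'v) \<Rightarrow> ('b \<Rightarrow> 'e \<times> nat) \<Rightarrow> ('a \<Rightarrow>\<^sub>0 'k::field) \<Rightarrow>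
     ('v, 'e) gen list \<Rightarrow> ('a \<Rightarrow>\<^sub>0 'k)" where
  "word_act F \<phi>0 \<phi>1 = foldl (\<lambda>x g. linear_ext (basis_act F \<phi>0 \<phi>1 g) x)"

definition free_act ::
  "('a, 'b) pre_digraph \<Rightarrow> ('a \<Rightarrow> 'v) \<Rightarrow> ('b \<Rightarrow> 'e \<times> nat) \<Rightarrow> ('a \<Rightarrow>\<^sub>0 'k::field) \<Rightarrow>
     ('v, 'e, 'k) free_elem \<Rightarrow> ('a \<Rightarrow>\<^sub>0 'k)" where
  "free_act F \<phi>0 \<phi>1 x p = linear_ext (\<lambda>u. word_act F \<phi>0 \<phi>1 x (letters u)) p"

text \<open>The action of a coset is the common value of the action of its representatives, see
  \<open>rep_act_class\<close> below.\<close>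

definition rep_act ::
  "('a, 'b) pre_digraph \<Rightarrow> ('a \<Rightarrow> 'v) \<Rightarrow> ('b \<Rightarrow> 'e \<times> nat) \<Rightarrow> ('a \<Rightarrow>\<^sub>0 'k::field) \<Rightarrow>
     ('v, 'e, 'k) wlpa_elem \<Rightarrow> ('a \<Rightarrow>\<^sub>0 'k)" where
  "rep_act F \<phi>0 \<phi>1 x P = the_elem (free_act F \<phi>0 \<phi>1 x ` P)"


section \<open>The algebra is well defined\<close>

lemma pm_scale_conv_mult: "pm_scale c p = Poly_Mapping.single 0 c * (p :: 'g fword \<Rightarrow>\<^sub>0 'k::field)"
  by (simp add: pm_scale_def mult_map_scale_conv_mult)

lemma pm_scale_conv_mult': "pm_scale c p = (p :: 'g fword \<Rightarrow>\<^sub>0 'k::field) * Poly_Mapping.single 0 c"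
proof (induction p rule: poly_mapping_induct_single)
  case (2 u d)
  show ?case by (simp add: mult_single mult.commute)
next
  case (3 p q)
  then show ?case by (simp add: pm.scale_right_distrib distrib_right)
qed auto

lemma mult_pm_scale_left:
  "pm_scale c p * q = pm_scale c (p * q :: 'g fword \<Rightarrow>\<^sub>0 'k::field)"
  by (simp add: pm_scale_conv_mult mult.assoc)

lemma mult_pm_scale_right:
  "p * pm_scale c q = pm_scale c (p * q :: 'g fword \<Rightarrow>\<^sub>0 'k::field)"
  by (simp add: pm_scale_conv_mult' mult.assoc)

lemma free_algebra_zero: "0 \<in> free_algebra X"
  by (simp add: free_algebra_def)

lemma free_algebra_add:
  "p \<in> free_algebra X \<Longrightarrow> q \<in> free_algebra X \<Longrightarrow> p + q \<in> free_algebra X"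
  using Poly_Mapping.keys_add[of p q] unfolding free_algebra_def by blast

lemma free_algebra_scale: "p \<in> free_algebra X \<Longrightarrow> pm_scale c p \<in> free_algebra X"
  by (auto simp: free_algebra_def in_keys_iff)

lemma free_algebra_uminus: "p \<in> free_algebra X \<Longrightarrow> - p \<in> free_algebra X"
  using free_algebra_scale[of p X "-1"] by simp

lemma free_algebra_diff:
  "p \<in> free_algebra X \<Longrightarrow> q \<in> free_algebra X \<Longrightarrow> p - q \<in> free_algebra X"
  using free_algebra_add[of p X "- q"] free_algebra_uminus[of q X] by simp

lemma free_algebra_mult:
  assumes "p \<in> free_algebra X" "q \<in> free_algebra X"
  shows "p * q \<in> free_algebra X"
proof -
  have "letters u \<noteq> [] \<and> set (letters u) \<subseteq> X" if u: "u \<in> Poly_Mapping.keys (p * q)" for u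
  proof -
    obtain a b where "a \<in> Poly_Mapping.keys p" "b \<in> Poly_Mapping.keys q" "u = a + b"
      using u Poly_Mapping.keys_mult[of p q] by blast
    then show ?thesis using assms by (auto simp: free_algebra_def plus_fword_def)
  qed
  then show ?thesis by (simp add: free_algebra_def)
qed

lemma free_algebra_sum:
  "(\<And>i. i \<in> I \<Longrightarrow> f i \<in> free_algebra X) \<Longrightarrow> sum f I \<in> free_algebra X"
  by (induction I rule: infinite_finite_induct) (auto intro: free_algebra_zero free_algebra_add)

lemma free_algebra_gen: "g \<in> X \<Longrightarrow> gen_elem g \<in> free_algebra X"
  by (simp add: free_algebra_def gen_elem_def)

lemma free_algebra_arc:
  "e \<in> arcs E \<Longrightarrow> 1 \<le> i \<Longrightarrow> arc_elem w e i \<in> free_algebra (gens E w)"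
  by (auto simp: arc_elem_def free_algebra_zero gens_def double_graph_def hat_graph_def
      intro!: free_algebra_gen)

lemma free_algebra_ghost:
  "e \<in> arcs E \<Longrightarrow> 1 \<le> i \<Longrightarrow> ghost_elem w e i \<in> free_algebra (gens E w)"
  by (auto simp: ghost_elem_def free_algebra_zero gens_def double_graph_def hat_graph_def
      intro!: free_algebra_gen)

lemma free_algebra_vert: "v \<in> verts E \<Longrightarrow> vert_elem v \<in> free_algebra (gens E w)"
  by (auto simp: gens_def intro!: free_algebra_gen)

lemma (in wf_digraph) wlpa_relations_subset: "wlpa_relations G w \<subseteq> free_algebra (gens G w)"
proof
  fix r assume "r \<in> wlpa_relations G w"
  then show "r \<in> free_algebra (gens G w)"
  proof cases
    case (vert_mult u v)
    then show ?thesis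
      by (simp add: free_algebra_diff free_algebra_mult free_algebra_vert free_algebra_zero)
  next
    case (ghost_arc v e f)
    then have "(\<Sum>i = 1..vertex_weight G w v. ghost_elem w e i * arc_elem w f i)
        \<in> free_algebra (gens G w)"
      by (intro free_algebra_sum free_algebra_mult free_algebra_arc free_algebra_ghost) auto
    with ghost_arc show ?thesis
      by (auto intro!: free_algebra_diff free_algebra_vert free_algebra_zero)
  next
    case (arc_ghost v i j)
    then have "(\<Sum>e\<in>out_arcs G v. arc_elem w e i * ghost_elem w e j) \<in> free_algebra (gens G w)"
      by (intro free_algebra_sum free_algebra_mult free_algebra_arc free_algebra_ghost) auto
    with arc_ghost show ?thesis
      by (auto intro!: free_algebra_diff free_algebra_vert free_algebra_zero)
  qed (simp_all add: free_algebra_diff free_algebra_mult free_algebra_vert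
      free_algebra_arc free_algebra_ghost)
qed

lemma (in wf_digraph) wlpa_ideal_subset: "wlpa_ideal G w \<subseteq> free_algebra (gens G w)"
proof
  fix r assume "r \<in> wlpa_ideal G w"
  then show "r \<in> free_algebra (gens G w)"
    by induction (use wlpa_relations_subset in \<open>auto intro: free_algebra_add free_algebra_mult
        free_algebra_scale free_algebra_zero\<close>)
qed

lemma wlpa_ideal_uminus: "p \<in> wlpa_ideal E w \<Longrightarrow> - p \<in> wlpa_ideal E w"
  using wlpa_ideal.scale[of p E w "-1"] by simp

lemma equiv_wlpa_cong: "equiv (free_algebra (gens E w)) (wlpa_cong E w)"
proof (rule equivI)
  show "wlpa_cong E w \<subseteq> free_algebra (gens E w) \<times> free_algebra (gens E w)"
    by (auto simp: wlpa_cong_def)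
  show "refl_on (free_algebra (gens E w)) (wlpa_cong E w)"
    by (auto simp: refl_on_def wlpa_cong_def wlpa_ideal.zero)
  show "sym (wlpa_cong E w)"
    by (rule symI) (use wlpa_ideal_uminus in \<open>force simp: wlpa_cong_def\<close>)
  show "trans (wlpa_cong E w)"
  proof (rule transI)
    fix p q r assume "(p, q) \<in> wlpa_cong E w" "(q, r) \<in> wlpa_cong E w"
    then show "(p, r) \<in> wlpa_cong E w"
      using wlpa_ideal.add[of "p - q" E w "q - r"] by (auto simp: wlpa_cong_def)
  qed
qed

lemma wlpa_class_eq:
  "(p, q) \<in> wlpa_cong E w \<Longrightarrow> wlpa_class E w p = wlpa_class E w q"
  by (rule equiv_class_eq[OF equiv_wlpa_cong])

lemma wlpa_cong_add:
  assumes "(p, p') \<in> wlpa_cong E w" "(q, q') \<in> wlpa_cong E w"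
  shows "(p + q, p' + q') \<in> wlpa_cong E w"
  using assms wlpa_ideal.add[of "p - p'" E w "q - q'"]
  by (auto simp: wlpa_cong_def free_algebra_add algebra_simps)

lemma wlpa_cong_scale:
  assumes "(p, p') \<in> wlpa_cong E w"
  shows "(pm_scale c p, pm_scale c p') \<in> wlpa_cong E w"
  using assms wlpa_ideal.scale[of "p - p'" E w c]
  by (auto simp: wlpa_cong_def free_algebra_scale pm.scale_right_diff_distrib)

lemma wlpa_cong_mult:
  assumes "(p, p') \<in> wlpa_cong E w" "(q, q') \<in> wlpa_cong E w"
  shows "(p * q, p' * q') \<in> wlpa_cong E w"
proof -
  have "(p - p') * q + p' * (q - q') \<in> wlpa_ideal E w"
    using assms unfolding wlpa_cong_def
    by (intro wlpa_ideal.add wlpa_ideal.mult_left wlpa_ideal.mult_right) auto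
  then show ?thesis
    using assms by (auto simp: wlpa_cong_def free_algebra_mult algebra_simps)
qed

lemma wlpa_nzero: "nzero (wlpa E w) = wlpa_class E w 0"
  by (simp add: wlpa_def)

lemma wlpa_carr: "carr (wlpa E w) = free_algebra (gens E w) // wlpa_cong E w"
  by (simp add: wlpa_def)

lemma wlpa_class_carr: "p \<in> free_algebra (gens E w) \<Longrightarrow> wlpa_class E w p \<in> carr (wlpa E w)"
  by (auto simp: wlpa_carr intro: quotientI)

lemma wlpa_nadd:
  assumes "p \<in> free_algebra (gens E w)" "q \<in> free_algebra (gens E w)"
  shows "nadd (wlpa E w) (wlpa_class E w p) (wlpa_class E w q) = wlpa_class E w (p + q)"
  using UN_equiv_class2[OF equiv_wlpa_cong equiv_wlpa_cong _ assms,
      of "\<lambda>p q. wlpa_class E w (p + q)"]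
  by (auto simp: wlpa_def intro!: congruent2I' wlpa_class_eq wlpa_cong_add)

lemma wlpa_nmult:
  assumes "p \<in> free_algebra (gens E w)" "q \<in> free_algebra (gens E w)"
  shows "nmult (wlpa E w) (wlpa_class E w p) (wlpa_class E w q) = wlpa_class E w (p * q)"
  using UN_equiv_class2[OF equiv_wlpa_cong equiv_wlpa_cong _ assms,
      of "\<lambda>p q. wlpa_class E w (p * q)"]
  by (auto simp: wlpa_def intro!: congruent2I' wlpa_class_eq wlpa_cong_mult)

lemma wlpa_nscale:
  assumes "p \<in> free_algebra (gens E w)"
  shows "nscale (wlpa E w) c (wlpa_class E w p) = wlpa_class E w (pm_scale c p)"
  using UN_equiv_class[OF equiv_wlpa_cong _ assms, of "\<lambda>p. wlpa_class E w (pm_scale c p)"]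
  by (auto simp: wlpa_def intro!: congruentI wlpa_class_eq wlpa_cong_scale)

lemma wlpa_carrE:
  assumes "P \<in> carr (wlpa E w)"
  obtains p where "p \<in> free_algebra (gens E w)" "P = wlpa_class E w p"
  using assms unfolding wlpa_carr by (auto elim: quotientE)

lemmas wlpa_simps = wlpa_nzero wlpa_nadd wlpa_nmult wlpa_nscale
  free_algebra_zero free_algebra_add free_algebra_mult free_algebra_scale wlpa_class_carr

theorem nonunital_algebra_wlpa:
  "nonunital_algebra (wlpa E w :: ('k::field, ('v, 'e, 'k) wlpa_elem) nualg)"
    (is "nonunital_algebra ?L")
proof
  fix a assume "a \<in> carr ?L"
  then obtain p where p: "p \<in> free_algebra (gens E w)" "a = wlpa_class E w p"
    by (rule wlpa_carrE)
  have "nadd ?L (wlpa_class E w (- p)) a = nzero ?L"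
    using p by (simp add: wlpa_simps free_algebra_uminus)
  then show "\<exists>b\<in>carr ?L. nadd ?L b a = nzero ?L"
    using p(1) by (auto intro!: wlpa_class_carr free_algebra_uminus)
next
  fix a b assume "a \<in> carr ?L" "b \<in> carr ?L"
  then show "nadd ?L a b = nadd ?L b a"
    by (elim wlpa_carrE) (simp add: wlpa_simps add.commute)
qed (((elim wlpa_carrE)?, simp add: wlpa_simps add.assoc mult.assoc distrib_left distrib_right
    pm.scale_left_distrib pm.scale_right_distrib mult_pm_scale_left mult_pm_scale_right)+)

section \<open>The module is well defined\<close>

lemma linear_ext_uminus: "linear_ext f (- x) = - linear_ext f x"
  using linear_ext_scale[of f "-1" x] by simp

lemma linear_ext_diff: "linear_ext f (x - y) = linear_ext f x - linear_ext f y"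
  using linear_ext_add[of f x "- y"] by (simp add: linear_ext_uminus)

lemma linear_ext_sum: "linear_ext f (sum g S) = (\<Sum>i\<in>S. linear_ext f (g i))"
  by (induction S rule: infinite_finite_induct) (auto simp: linear_ext_add)

lemma linear_ext_fun_add: "linear_ext (\<lambda>u. f u + g u) x = linear_ext f x + linear_ext g x"
  by (simp add: linear_ext_def pm.scale_right_distrib sum.distrib)

lemma linear_ext_fun_scale: "linear_ext (\<lambda>u. pm_scale c (f u)) x = pm_scale c (linear_ext f x)"
  by (simp add: linear_ext_def pm.scale_sum_right mult.commute)

lemma word_act_Nil [simp]: "word_act F \<phi>0 \<phi>1 x [] = x"
  and word_act_Cons [simp]: "word_act F \<phi>0 \<phi>1 x (g # gs) =
        word_act F \<phi>0 \<phi>1 (linear_ext (basis_act F \<phi>0 \<phi>1 g) x) gs"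
  and word_act_append: "word_act F \<phi>0 \<phi>1 x (gs @ hs) = word_act F \<phi>0 \<phi>1 (word_act F \<phi>0 \<phi>1 x gs) hs"
  by (simp_all add: word_act_def)

lemma word_act_add: "word_act F \<phi>0 \<phi>1 (x + y) gs = word_act F \<phi>0 \<phi>1 x gs + word_act F \<phi>0 \<phi>1 y gs"
  by (induction gs arbitrary: x y) (auto simp: linear_ext_add)

lemma word_act_scale: "word_act F \<phi>0 \<phi>1 (pm_scale c x) gs = pm_scale c (word_act F \<phi>0 \<phi>1 x gs)"
  by (induction gs arbitrary: x) (auto simp: linear_ext_scale)

lemma free_act_add_left: "free_act F \<phi>0 \<phi>1 (x + y) p = free_act F \<phi>0 \<phi>1 x p + free_act F \<phi>0 \<phi>1 y p"
  by (simp add: free_act_def word_act_add linear_ext_fun_add)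

lemma free_act_scale_left: "free_act F \<phi>0 \<phi>1 (pm_scale c x) p = pm_scale c (free_act F \<phi>0 \<phi>1 x p)"
  by (simp add: free_act_def word_act_scale linear_ext_fun_scale)

lemma free_act_zero_left [simp]: "free_act F \<phi>0 \<phi>1 0 p = 0"
  using free_act_scale_left[of F \<phi>0 \<phi>1 0 0 p] by simp

lemma free_act_zero_right [simp]: "free_act F \<phi>0 \<phi>1 x 0 = 0"
  and free_act_add_right: "free_act F \<phi>0 \<phi>1 x (p + q) = free_act F \<phi>0 \<phi>1 x p + free_act F \<phi>0 \<phi>1 x q"
  and free_act_diff_right: "free_act F \<phi>0 \<phi>1 x (p - q) = free_act F \<phi>0 \<phi>1 x p - free_act F \<phi>0 \<phi>1 x q"
  and free_act_scale_right: "free_act F \<phi>0 \<phi>1 x (pm_scale c p) = pm_scale c (free_act F \<phi>0 \<phi>1 x p)"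
  and free_act_sum_right: "free_act F \<phi>0 \<phi>1 x (sum h S) = (\<Sum>i\<in>S. free_act F \<phi>0 \<phi>1 x (h i))"
  by (simp_all add: free_act_def linear_ext_add linear_ext_diff linear_ext_scale linear_ext_sum)

lemma free_act_single [simp]:
  "free_act F \<phi>0 \<phi>1 x (Poly_Mapping.single u c) = pm_scale c (word_act F \<phi>0 \<phi>1 x (letters u))"
  by (simp add: free_act_def)

lemma free_act_mult: "free_act F \<phi>0 \<phi>1 x (p * q) = free_act F \<phi>0 \<phi>1 (free_act F \<phi>0 \<phi>1 x p) q"
proof (induction p rule: poly_mapping_induct_single)
  case (2 u c)
  show ?case
  proof (induction q rule: poly_mapping_induct_single)
    case (2 v d)
    show ?case
      by (simp add: mult_single plus_fword_def word_act_append word_act_scale mult.commute)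
  qed (simp_all add: distrib_left free_act_add_right)
next
  case (3 p q)
  then show ?case by (simp add: distrib_right free_act_add_right free_act_add_left)
qed simp

lemma free_act_gen [simp]:
  "free_act F \<phi>0 \<phi>1 (basis_elem v) (gen_elem g) = basis_act F \<phi>0 \<phi>1 g v"
  by (simp add: gen_elem_def)

lemma rep_module_zero: "0 \<in> rep_module F"
  by (simp add: rep_module_def)

lemma rep_module_basis: "v \<in> verts F \<Longrightarrow> basis_elem v \<in> rep_module F"
  by (simp add: rep_module_def)

lemma rep_module_add: "x \<in> rep_module F \<Longrightarrow> y \<in> rep_module F \<Longrightarrow> x + y \<in> rep_module F"
  using Poly_Mapping.keys_add[of x y] unfolding rep_module_def by blast

lemma rep_module_scale: "x \<in> rep_module F \<Longrightarrow> pm_scale c x \<in> rep_module F"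
  by (auto simp: rep_module_def in_keys_iff)

lemma rep_module_sum: "(\<And>i. i \<in> I \<Longrightarrow> h i \<in> rep_module F) \<Longrightarrow> sum h I \<in> rep_module F"
  by (induction I rule: infinite_finite_induct) (auto intro: rep_module_zero rep_module_add)

context representation_graph
begin

lemma arc_props:
  assumes "f \<in> arcs F"
  shows "st (\<phi>1 f) \<in> arcs E" "1 \<le> tag (\<phi>1 f)" "tag (\<phi>1 f) \<le> w (st (\<phi>1 f))"
    "tail E (st (\<phi>1 f)) = \<phi>0 (tail F f)" "head E (st (\<phi>1 f)) = \<phi>0 (head F f)"
  using hom assms by (cases "\<phi>1 f"; force simp: graph_hom_def hat_graph_def)+

lemma vert_props: "v \<in> verts F \<Longrightarrow> \<phi>0 v \<in> verts E"
  using hom by (auto simp: graph_hom_def hat_graph_def)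

lemma weight_le_vertex_weight:
  assumes "e \<in> arcs E"
  shows "w e \<le> vertex_weight E w (tail E e)"
proof -
  have "finite (out_arcs E (tail E e))" "e \<in> out_arcs E (tail E e)"
    using assms by (auto intro: row_finite)
  then show ?thesis by (auto simp: vertex_weight_def)
qed

lemma out_unique:
  assumes "f \<in> out_arcs F v" "g \<in> out_arcs F v" "tag (\<phi>1 f) = tag (\<phi>1 g)"
  shows "f = g"
proof -
  have f: "f \<in> arcs F" "tail F f = v" using assms by auto
  have "tag (\<phi>1 f) \<le> vertex_weight E w (\<phi>0 v)"
    using arc_props[OF f(1)] f(2) weight_le_vertex_weight[of "st (\<phi>1 f)"] by simp
  then show ?thesis
    using unique_tag[of v "tag (\<phi>1 f)"] arc_props(2)[OF f(1)] F.tail_in_verts[OF f(1)] f(2) assms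
    by auto
qed

lemma in_unique:
  assumes "f \<in> in_arcs F v" "g \<in> in_arcs F v" "st (\<phi>1 f) = st (\<phi>1 g)"
  shows "f = g"
proof -
  have f: "f \<in> arcs F" "head F f = v" using assms by auto
  have "st (\<phi>1 f) \<in> in_arcs E (\<phi>0 v)" using arc_props[OF f(1)] f(2) by auto
  then show ?thesis
    using unique_st[of v "st (\<phi>1 f)"] F.head_in_verts[OF f(1)] f(2) assms by auto
qed

lemma basis_act_Fwd:
  assumes "f \<in> out_arcs F v"
  shows "basis_act F \<phi>0 \<phi>1 (Arc (Fwd a)) v =
           (if \<phi>1 f = a then basis_elem (head F f)
            else if tag (\<phi>1 f) = tag a then 0 else basis_act F \<phi>0 \<phi>1 (Arc (Fwd a)) v)"
proof -
  have "(THE g. g \<in> out_arcs F v \<and> \<phi>1 g = a) = f" if "\<phi>1 f = a"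
    by (rule the_equality) (use assms that out_unique in force)+
  then show ?thesis using assms out_unique by force
qed

lemma basis_act_Rev:
  assumes "f \<in> in_arcs F v"
  shows "basis_act F \<phi>0 \<phi>1 (Arc (Rev a)) v =
           (if \<phi>1 f = a then basis_elem (tail F f)
            else if st (\<phi>1 f) = st a then 0 else basis_act F \<phi>0 \<phi>1 (Arc (Rev a)) v)"
proof -
  have "(THE g. g \<in> in_arcs F v \<and> \<phi>1 g = a) = f" if "\<phi>1 f = a"
    by (rule the_equality) (use assms that in_unique in force)+
  then show ?thesis using assms in_unique by force
qed

lemma basis_act_Fwd_cases:
  fixes P :: "('a \<Rightarrow>\<^sub>0 'k::field) \<Rightarrow> bool"
  assumes "\<And>f. f \<in> out_arcs F v \<Longrightarrow> \<phi>1 f = a \<Longrightarrow> P (basis_elem (head F f))"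
    and "\<forall>f\<in>out_arcs F v. \<phi>1 f \<noteq> a \<Longrightarrow> P 0"
  shows "P (basis_act F \<phi>0 \<phi>1 (Arc (Fwd a)) v)"
proof (cases "\<exists>f. f \<in> out_arcs F v \<and> \<phi>1 f = a")
  case True
  then obtain f where f: "f \<in> out_arcs F v" "\<phi>1 f = a" by blast
  have "basis_act F \<phi>0 \<phi>1 (Arc (Fwd a)) v = (basis_elem (head F f) :: 'a \<Rightarrow>\<^sub>0 'k)"
    by (subst basis_act_Fwd[OF f(1)]) (simp add: f(2))
  with assms(1)[OF f] show ?thesis by metis
next
  case False
  then have "basis_act F \<phi>0 \<phi>1 (Arc (Fwd a)) v = (0 :: 'a \<Rightarrow>\<^sub>0 'k)" by auto
  with assms(2) False show ?thesis by metis
qed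

lemma basis_act_Rev_cases:
  fixes P :: "('a \<Rightarrow>\<^sub>0 'k::field) \<Rightarrow> bool"
  assumes "\<And>f. f \<in> in_arcs F v \<Longrightarrow> \<phi>1 f = a \<Longrightarrow> P (basis_elem (tail F f))"
    and "\<forall>f\<in>in_arcs F v. \<phi>1 f \<noteq> a \<Longrightarrow> P 0"
  shows "P (basis_act F \<phi>0 \<phi>1 (Arc (Rev a)) v)"
proof (cases "\<exists>f. f \<in> in_arcs F v \<and> \<phi>1 f = a")
  case True
  then obtain f where f: "f \<in> in_arcs F v" "\<phi>1 f = a" by blast
  have "basis_act F \<phi>0 \<phi>1 (Arc (Rev a)) v = (basis_elem (tail F f) :: 'a \<Rightarrow>\<^sub>0 'k)"
    by (subst basis_act_Rev[OF f(1)]) (simp add: f(2))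
  with assms(1)[OF f] show ?thesis by metis
next
  case False
  then have "basis_act F \<phi>0 \<phi>1 (Arc (Rev a)) v = (0 :: 'a \<Rightarrow>\<^sub>0 'k)" by auto
  with assms(2) False show ?thesis by metis
qed

lemma basis_act_closed:
  assumes "v \<in> verts F"
  shows "basis_act F \<phi>0 \<phi>1 g v \<in> rep_module F"
proof (cases g)
  case (Vert u)
  then show ?thesis using assms by (auto intro: rep_module_zero rep_module_basis)
next
  case (Arc d)
  show ?thesis
  proof (cases d)
    case (Fwd a)
    show ?thesis unfolding Arc Fwd
      by (rule basis_act_Fwd_cases[where P = "\<lambda>y. y \<in> rep_module F"])
         (auto intro!: rep_module_zero rep_module_basis)
  next
    case (Rev a)
    show ?thesis unfolding Arc Rev
      by (rule basis_act_Rev_cases[where P = "\<lambda>y. y \<in> rep_module F"])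
         (auto intro!: rep_module_zero rep_module_basis)
  qed
qed

lemma word_act_closed: "x \<in> rep_module F \<Longrightarrow> word_act F \<phi>0 \<phi>1 x gs \<in> rep_module F"
proof (induction gs arbitrary: x)
  case (Cons g gs)
  have "linear_ext (basis_act F \<phi>0 \<phi>1 g) x \<in> rep_module F"
    unfolding linear_ext_def
    using Cons.prems by (intro rep_module_sum rep_module_scale basis_act_closed)
      (auto simp: rep_module_def)
  then show ?case using Cons.IH by simp
qed simp

lemma free_act_closed: "x \<in> rep_module F \<Longrightarrow> free_act F \<phi>0 \<phi>1 x p \<in> rep_module F"
  unfolding free_act_def linear_ext_def by (intro rep_module_sum rep_module_scale word_act_closed)

lemma free_act_arc:
  assumes "v \<in> verts F"
  shows "free_act F \<phi>0 \<phi>1 (basis_elem v) (arc_elem w e i) = basis_act F \<phi>0 \<phi>1 (Arc (Fwd (e, i))) v"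
proof (cases "i \<le> w e")
  case False
  have "basis_act F \<phi>0 \<phi>1 (Arc (Fwd (e, i))) v = 0"
    by (rule basis_act_Fwd_cases[where P = "\<lambda>y. y = 0"]) (use False arc_props(3) in force)+
  then show ?thesis using False by (simp add: arc_elem_def)
qed (simp add: arc_elem_def)

lemma free_act_ghost:
  assumes "v \<in> verts F"
  shows "free_act F \<phi>0 \<phi>1 (basis_elem v) (ghost_elem w e i) = basis_act F \<phi>0 \<phi>1 (Arc (Rev (e, i))) v"
proof (cases "i \<le> w e")
  case False
  have "basis_act F \<phi>0 \<phi>1 (Arc (Rev (e, i))) v = 0"
    by (rule basis_act_Rev_cases[where P = "\<lambda>y. y = 0"]) (use False arc_props(3) in force)+
  then show ?thesis using False by (simp add: ghost_elem_def)
qed (simp add: ghost_elem_def)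

lemma free_act_ghost_arc:
  assumes x: "x \<in> verts F" and v: "v \<in> verts E" and e: "e \<in> out_arcs E v" and f: "f \<in> out_arcs E v"
  shows "free_act F \<phi>0 \<phi>1 (basis_elem x)
           (\<Sum>i = 1..vertex_weight E w v. ghost_elem w e i * arc_elem w f i) =
         (if e = f \<and> \<phi>0 x = head E e then basis_elem x else 0)"
proof (cases "\<phi>0 x = head E e")
  case True
  then obtain h where h: "h \<in> in_arcs F x" "st (\<phi>1 h) = e"
    using unique_st[of x e] x e by auto
  let ?i = "tag (\<phi>1 h)"
  have h': "h \<in> arcs F" "head F h = x" using h by auto
  note hp = arc_props[OF h'(1)]
  have tl: "tail F h \<in> verts F" "h \<in> out_arcs F (tail F h)" using h' by auto
  have i: "?i \<in> {1..vertex_weight E w v}"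
    using hp h(2) e weight_le_vertex_weight[of e] by auto
  have ghost: "free_act F \<phi>0 \<phi>1 (basis_elem x) (ghost_elem w e i) =
                 (if i = ?i then basis_elem (tail F h) else 0)" for i
    using basis_act_Rev[OF h(1), of "(e, i)"] h(2) x
    by (auto simp: free_act_ghost prod_eq_iff simp del: basis_act.simps split: if_splits)
  have arc: "free_act F \<phi>0 \<phi>1 (basis_elem (tail F h)) (arc_elem w f ?i) =
               (if e = f then basis_elem x else 0)"
    using basis_act_Fwd[OF tl(2), of "(f, ?i)"] h(2) h' tl(1)
    by (auto simp: free_act_arc prod_eq_iff simp del: basis_act.simps split: if_splits)
  have "free_act F \<phi>0 \<phi>1 (basis_elem x)
           (\<Sum>i = 1..vertex_weight E w v. ghost_elem w e i * arc_elem w f i) =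
        (\<Sum>i = 1..vertex_weight E w v. if i = ?i then if e = f then basis_elem x else 0 else 0)"
    unfolding free_act_sum_right
    by (rule sum.cong) (auto simp: free_act_mult ghost arc)
  also have "\<dots> = (if e = f then basis_elem x else 0)"
    using i by (simp add: sum.delta)
  finally show ?thesis using True by simp
next
  case False
  have zero: "free_act F \<phi>0 \<phi>1 (basis_elem x) (ghost_elem w e i) = 0" for i
    unfolding free_act_ghost[OF x]
    by (rule basis_act_Rev_cases[where P = "\<lambda>y. y = 0"]) (use False arc_props(5) in force)+
  show ?thesis
    using False unfolding free_act_sum_right free_act_mult by (auto intro!: sum.neutral simp: zero)
qed

lemma free_act_arc_ghost:
  assumes x: "x \<in> verts F" and v: "v \<in> verts E"
    and i: "1 \<le> i" "i \<le> vertex_weight E w v" and j: "1 \<le> j" "j \<le> vertex_weight E w v"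
  shows "free_act F \<phi>0 \<phi>1 (basis_elem x) (\<Sum>e\<in>out_arcs E v. arc_elem w e i * ghost_elem w e j) =
         (if i = j \<and> \<phi>0 x = v then basis_elem x else 0)"
proof (cases "\<phi>0 x = v")
  case True
  then obtain h where h: "h \<in> out_arcs F x" "tag (\<phi>1 h) = i"
    using unique_tag[of x i] x i by auto
  let ?e = "st (\<phi>1 h)"
  have h': "h \<in> arcs F" "tail F h = x" using h by auto
  note hp = arc_props[OF h'(1)]
  have hd: "head F h \<in> verts F" "h \<in> in_arcs F (head F h)" using h' by auto
  have e: "?e \<in> out_arcs E v" using hp h' True by auto
  have arc: "free_act F \<phi>0 \<phi>1 (basis_elem x) (arc_elem w e i) =
                 (if e = ?e then basis_elem (head F h) else 0)" for e
    using basis_act_Fwd[OF h(1), of "(e, i)"] h(2) x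
    by (auto simp: free_act_arc prod_eq_iff simp del: basis_act.simps split: if_splits)
  have ghost: "free_act F \<phi>0 \<phi>1 (basis_elem (head F h)) (ghost_elem w ?e j) =
               (if i = j then basis_elem x else 0)"
    using basis_act_Rev[OF hd(2), of "(?e, j)"] h(2) h' hd(1)
    by (auto simp: free_act_ghost prod_eq_iff simp del: basis_act.simps split: if_splits)
  have "free_act F \<phi>0 \<phi>1 (basis_elem x) (\<Sum>e\<in>out_arcs E v. arc_elem w e i * ghost_elem w e j) =
        (\<Sum>e\<in>out_arcs E v. if e = ?e then if i = j then basis_elem x else 0 else 0)"
    unfolding free_act_sum_right
    by (rule sum.cong) (auto simp: free_act_mult ghost arc)
  also have "\<dots> = (if i = j then basis_elem x else 0)"
    using e row_finite[OF v] by (simp add: sum.delta)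
  finally show ?thesis using True by simp
next
  case False
  have zero: "free_act F \<phi>0 \<phi>1 (basis_elem x) (arc_elem w e i) = 0" if "e \<in> out_arcs E v" for e
    unfolding free_act_arc[OF x]
    by (rule basis_act_Fwd_cases[where P = "\<lambda>y. y = 0"]) (use False that arc_props(4) in force)+
  show ?thesis
    using False unfolding free_act_sum_right free_act_mult by (auto intro!: sum.neutral simp: zero)
qed

lemma free_act_relation:
  fixes r :: "('v, 'e, 'k::field) free_elem"
  assumes "r \<in> wlpa_relations E w" and x: "x \<in> verts F"
  shows "free_act F \<phi>0 \<phi>1 (basis_elem x) r = 0"
  using assms(1)
proof cases
  case (vert_mult u v)
  then show ?thesis by (auto simp: free_act_diff_right free_act_mult)
next
  case (tail_arc e i)
  have "\<phi>0 x = tail E e \<or> basis_act F \<phi>0 \<phi>1 (Arc (Fwd (e, i))) x = (0 :: 'a \<Rightarrow>\<^sub>0 'k)"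
    by (rule basis_act_Fwd_cases[where P = "\<lambda>y. \<phi>0 x = tail E e \<or> y = 0"])
       (use arc_props(4) in force)+
  then show ?thesis
    unfolding tail_arc(1) free_act_diff_right free_act_mult free_act_gen free_act_arc[OF x]
    by (auto simp: free_act_arc[OF x] simp del: basis_act.simps(2,3))
next
  case (arc_head e i)
  have "free_act F \<phi>0 \<phi>1 (basis_act F \<phi>0 \<phi>1 (Arc (Fwd (e, i))) x) (vert_elem (head E e)) =
        (basis_act F \<phi>0 \<phi>1 (Arc (Fwd (e, i))) x :: 'a \<Rightarrow>\<^sub>0 'k)"
    by (rule basis_act_Fwd_cases[where P = "\<lambda>y. free_act F \<phi>0 \<phi>1 y (vert_elem (head E e)) = y"])
       (use arc_props(5) in force)+
  then show ?thesis
    unfolding arc_head(1) free_act_diff_right free_act_mult free_act_arc[OF x] by simp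
next
  case (head_ghost e i)
  have "\<phi>0 x = head E e \<or> basis_act F \<phi>0 \<phi>1 (Arc (Rev (e, i))) x = (0 :: 'a \<Rightarrow>\<^sub>0 'k)"
    by (rule basis_act_Rev_cases[where P = "\<lambda>y. \<phi>0 x = head E e \<or> y = 0"])
       (use arc_props(5) in force)+
  then show ?thesis
    unfolding head_ghost(1) free_act_diff_right free_act_mult free_act_gen free_act_ghost[OF x]
    by (auto simp: free_act_ghost[OF x] simp del: basis_act.simps(2,3))
next
  case (ghost_tail e i)
  have "free_act F \<phi>0 \<phi>1 (basis_act F \<phi>0 \<phi>1 (Arc (Rev (e, i))) x) (vert_elem (tail E e)) =
        (basis_act F \<phi>0 \<phi>1 (Arc (Rev (e, i))) x :: 'a \<Rightarrow>\<^sub>0 'k)"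
    by (rule basis_act_Rev_cases[where P = "\<lambda>y. free_act F \<phi>0 \<phi>1 y (vert_elem (tail E e)) = y"])
       (use arc_props(4) in force)+
  then show ?thesis
    unfolding ghost_tail(1) free_act_diff_right free_act_mult free_act_ghost[OF x] by simp
next
  case (ghost_arc v e f)
  show ?thesis
    unfolding ghost_arc(1) free_act_diff_right free_act_ghost_arc[OF x ghost_arc(2-4)] by simp
next
  case (arc_ghost v i j)
  show ?thesis
    unfolding arc_ghost(1) free_act_diff_right free_act_arc_ghost[OF x arc_ghost(2-6)] by simp
qed

lemma free_act_conv_basis:
  "free_act F \<phi>0 \<phi>1 x p = linear_ext (\<lambda>v. free_act F \<phi>0 \<phi>1 (basis_elem v) p) x"
proof (induction x rule: poly_mapping_induct_single)
  case (2 v c)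
  show ?case using free_act_scale_left[of F \<phi>0 \<phi>1 c "basis_elem v" p] by simp
qed (simp_all add: free_act_add_left linear_ext_add)

lemma free_act_ideal:
  assumes "r \<in> wlpa_ideal E w" "x \<in> rep_module F"
  shows "free_act F \<phi>0 \<phi>1 x r = 0"
  using assms
proof (induction arbitrary: x)
  case (relation r)
  then show ?case
    by (subst free_act_conv_basis)
       (auto simp: linear_ext_def rep_module_def free_act_relation intro!: sum.neutral)
qed (auto simp: free_act_add_right free_act_scale_right free_act_mult free_act_closed)

lemma rep_act_class:
  assumes "x \<in> rep_module F" "p \<in> free_algebra (gens E w)"
  shows "rep_act F \<phi>0 \<phi>1 x (wlpa_class E w p) = free_act F \<phi>0 \<phi>1 x p"
proof -
  have "free_act F \<phi>0 \<phi>1 x q = free_act F \<phi>0 \<phi>1 x p" if "(p, q) \<in> wlpa_cong E w" for q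
    using that free_act_ideal[of "p - q" x] assms(1)
    by (auto simp: wlpa_cong_def free_act_diff_right)
  moreover have "p \<in> wlpa_class E w p"
    using assms(2) by (auto simp: wlpa_cong_def wlpa_ideal.zero)
  ultimately have "free_act F \<phi>0 \<phi>1 x ` wlpa_class E w p = {free_act F \<phi>0 \<phi>1 x p}"
    by blast
  then show ?thesis by (simp add: rep_act_def)
qed

lemma rep_act_scale:
  assumes "x \<in> rep_module F" "P \<in> carr (wlpa E w)"
  shows "rep_act F \<phi>0 \<phi>1 x (nscale (wlpa E w) c P) = pm_scale c (rep_act F \<phi>0 \<phi>1 x P)"
    and "rep_act F \<phi>0 \<phi>1 (pm_scale c x) P = pm_scale c (rep_act F \<phi>0 \<phi>1 x P)"
  using assms
  by (elim wlpa_carrE, simp add: rep_act_class wlpa_simps rep_module_scale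
      free_act_scale_left free_act_scale_right)+

theorem right_module_rep:
  "right_module (wlpa E w) (rep_module F :: ('a \<Rightarrow>\<^sub>0 'k::field) set) (rep_act F \<phi>0 \<phi>1)"
proof -
  interpret nonunital_algebra "wlpa E w :: ('k, ('v, 'e, 'k) wlpa_elem) nualg"
    by (rule nonunital_algebra_wlpa)
  show ?thesis
  proof
    show "additive_subgroup (rep_module F :: ('a \<Rightarrow>\<^sub>0 'k) set)"
      using rep_module_scale[of _ F "-1"]
      by (auto simp: additive_subgroup_def rep_module_zero rep_module_add)
  qed ((elim wlpa_carrE, simp add: rep_act_class wlpa_simps rep_module_add free_act_closed
        free_act_add_left free_act_add_right free_act_mult)+)
qed

end

end

theory Submission
  imports Defs
begin

text \<open>
  A word \<open>m\<close> in the generators acts on a vertex \<open>v\<close> of \<open>F\<close> by lifting \<open>m\<close> to a walk in the double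
  graph of \<open>F\<close> that starts at \<open>v\<close>: the result is the end of the lift, or \<open>0\<close> if there is no lift.
  The two uniqueness conditions of a representation graph say that a lift is determined by its start
  and also by its end. Hence every word is a partial injection of the vertices
  (\<open>word_moves_functional\<close>, \<open>word_moves_injective\<close>), and when it acts on a vector, no terms cancel
  (\<open>lookup_word_act\<close>). Moreover, a nonempty word that does not annihilate a vector acts on it as a
  path (\<open>word_acts_as_path\<close>), so it makes no difference whether words or paths are used below.

  If \<open>F\<close> is irreducible and \<open>x\<close> has two different vertices in its support, some path can be lifted
  from one of them but not from the other. It maps \<open>x\<close> to a nonzero vector of smaller support, and
  induction on the size of the support ends at a multiple of one vertex
  (\<open>irreducible_reaches_vertex\<close>). Conversely, if the same paths can be lifted from \<open>u\<close> and \<open>v\<close>, then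
  every word moves both or annihilates both, so all elements of \<open>(u - v) \<cdot> L\<close> have coefficient sum
  \<open>0\<close> and none of them is a vertex (\<open>coeff_sum_same_paths\<close>).

  Simplicity is then the usual argument with cyclic submodules. If \<open>V\<close> is simple, \<open>x \<cdot> L = V\<close>
  contains every vertex, and a vertex in \<open>u \<cdot> L\<close> is joined to \<open>u\<close> by the lift of a word. If each
  nonzero submodule contains a vertex and \<open>F\<close> is connected, it contains all vertices.
\<close>

section \<open>Words as partial injections of the vertices\<close>

lemma double_graph_simps [simp]:
  "verts (double_graph G) = verts G"
  "arcs (double_graph G) = Fwd ` arcs G \<union> Rev ` arcs G"
  "tail (double_graph G) = case_darc (tail G) (head G)"
  "head (double_graph G) = case_darc (head G) (tail G)"
  by (simp_all add: double_graph_def)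

lemma hat_graph_simps [simp]:
  "verts (hat_graph E w) = verts E"
  "arcs (hat_graph E w) = {(e, i). e \<in> arcs E \<and> 1 \<le> i \<and> i \<le> w e}"
  "tail (hat_graph E w) a = tail E (st a)"
  "head (hat_graph E w) a = head E (st a)"
  by (simp_all add: hat_graph_def case_prod_beta)

fun word_arcs :: "('v, 'e) gen list \<Rightarrow> ('e \<times> nat) darc list" where
  "word_arcs [] = []"
| "word_arcs (Vert a # gs) = word_arcs gs"
| "word_arcs (Arc d # gs) = d # word_arcs gs"

lemma word_arcs_map_Arc [simp]: "word_arcs (map Arc es) = es"
  by (induction es) auto

lemma word_arcs_path_word [simp]: "word_arcs (path_word (a, es)) = es"
  by (cases es) auto

lemma path_word_nonempty [simp]: "path_word p \<noteq> []"
  by (cases p rule: path_word.cases) auto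

lemma lookup_linear_ext:
  "Poly_Mapping.lookup (linear_ext f x) v =
     (\<Sum>u\<in>Poly_Mapping.keys x. Poly_Mapping.lookup x u * Poly_Mapping.lookup (f u) v)"
  by (simp add: linear_ext_def lookup_sum)

context representation_graph
begin

text \<open>The condition \<open>u \<in> verts F\<close> in the first equation makes every nonempty word move vertices of
  \<open>F\<close> only; the second equation has it by well-formedness.\<close>

fun gen_moves :: "('v, 'e) gen \<Rightarrow> 'a \<Rightarrow> 'a \<Rightarrow> bool" where
  "gen_moves (Vert a) u v \<longleftrightarrow> u \<in> verts F \<and> \<phi>0 u = a \<and> v = u"
| "gen_moves (Arc d) u v \<longleftrightarrow>
     (\<exists>f\<in>arcs (double_graph F). map_darc \<phi>1 f = d \<and>
        tail (double_graph F) f = u \<and> head (double_graph F) f = v)"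

primrec word_moves :: "('v, 'e) gen list \<Rightarrow> 'a \<Rightarrow> 'a \<Rightarrow> bool" where
  "word_moves [] u v \<longleftrightarrow> u = v"
| "word_moves (g # gs) u v \<longleftrightarrow> (\<exists>z. gen_moves g u z \<and> word_moves gs z v)"

lemma gen_moves_Fwd:
  "gen_moves (Arc (Fwd a)) u v \<longleftrightarrow> (\<exists>f\<in>out_arcs F u. \<phi>1 f = a \<and> head F f = v)"
  by force

lemma gen_moves_Rev:
  "gen_moves (Arc (Rev a)) u v \<longleftrightarrow> (\<exists>f\<in>in_arcs F u. \<phi>1 f = a \<and> tail F f = v)"
  by force

declare gen_moves.simps(2) [simp del]

text \<open>An arc out of a vertex is determined by its tag and an arc into a vertex by its structure
  edge. Hence a labelled arc or reversed arc can be lifted in at most one way, both when the start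
  and when the end of the lift is prescribed.\<close>

lemma arc_determined_by_tail:
  "f \<in> arcs F \<Longrightarrow> g \<in> arcs F \<Longrightarrow> tail F f = tail F g \<Longrightarrow> \<phi>1 f = \<phi>1 g \<Longrightarrow> f = g"
  by (rule out_unique[of f "tail F f"]) auto

lemma arc_determined_by_head:
  "f \<in> arcs F \<Longrightarrow> g \<in> arcs F \<Longrightarrow> head F f = head F g \<Longrightarrow> \<phi>1 f = \<phi>1 g \<Longrightarrow> f = g"
  by (rule in_unique[of f "head F f"]) auto

lemma gen_moves_functional:
  assumes "gen_moves g u v" "gen_moves g u v'"
  shows "v = v'"
proof (cases g)
  case (Arc d)
  show ?thesis
  proof (cases d)
    case (Fwd a)
    obtain f f' where f: "f \<in> arcs F" "tail F f = u" "\<phi>1 f = a" "head F f = v"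
      and f': "f' \<in> arcs F" "tail F f' = u" "\<phi>1 f' = a" "head F f' = v'"
      using assms unfolding Arc Fwd gen_moves_Fwd by auto
    have "f = f'" by (rule arc_determined_by_tail) (simp_all add: f f')
    with f f' show ?thesis by simp
  next
    case (Rev a)
    obtain f f' where f: "f \<in> arcs F" "head F f = u" "\<phi>1 f = a" "tail F f = v"
      and f': "f' \<in> arcs F" "head F f' = u" "\<phi>1 f' = a" "tail F f' = v'"
      using assms unfolding Arc Rev gen_moves_Rev by auto
    have "f = f'" by (rule arc_determined_by_head) (simp_all add: f f')
    with f f' show ?thesis by simp
  qed
qed (use assms in simp)

lemma gen_moves_injective:
  assumes "gen_moves g u v" "gen_moves g u' v"
  shows "u = u'"
proof (cases g)
  case (Arc d)
  show ?thesis
  proof (cases d)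
    case (Fwd a)
    have "gen_moves (Arc (Rev a)) v u" "gen_moves (Arc (Rev a)) v u'"
      using assms unfolding Arc Fwd gen_moves_Fwd gen_moves_Rev by auto
    then show ?thesis by (rule gen_moves_functional)
  next
    case (Rev a)
    have "gen_moves (Arc (Fwd a)) v u" "gen_moves (Arc (Fwd a)) v u'"
      using assms unfolding Arc Rev gen_moves_Fwd gen_moves_Rev by auto
    then show ?thesis by (rule gen_moves_functional)
  qed
qed (use assms in simp)

lemma gen_moves_verts: "gen_moves g u v \<Longrightarrow> u \<in> verts F \<and> v \<in> verts F"
  by (cases g) (auto simp: gen_moves.simps(2))

lemma gen_moves_Arc_ends:
  assumes "gen_moves (Arc d) u v"
  shows "d \<in> arcs (double_graph (hat_graph E w))"
    and "tail (double_graph (hat_graph E w)) d = \<phi>0 u"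
    and "head (double_graph (hat_graph E w)) d = \<phi>0 v"
  using assms hom by (auto simp: gen_moves.simps(2) graph_hom_def simp del: hat_graph_simps)

lemma gen_moves_gens: "gen_moves g u v \<Longrightarrow> g \<in> gens E w"
  using vert_props gen_moves_Arc_ends(1) by (cases g) (auto simp: gens_def simp del: double_graph_simps)

lemma word_moves_functional: "word_moves gs u v \<Longrightarrow> word_moves gs u v' \<Longrightarrow> v = v'"
proof (induction gs arbitrary: u)
  case (Cons g gs)
  then show ?case using gen_moves_functional[of g u] by (metis word_moves.simps(2))
qed simp

lemma word_moves_injective: "word_moves gs u v \<Longrightarrow> word_moves gs u' v \<Longrightarrow> u = u'"
proof (induction gs arbitrary: u u')
  case (Cons g gs)
  then show ?case using gen_moves_injective[of g u _ u'] by (metis word_moves.simps(2))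
qed simp

lemma word_moves_verts: "word_moves gs u v \<Longrightarrow> u \<in> verts F \<Longrightarrow> v \<in> verts F"
  by (induction gs arbitrary: u) (auto dest: gen_moves_verts)

lemma word_moves_gens: "word_moves gs u v \<Longrightarrow> set gs \<subseteq> gens E w"
  by (induction gs arbitrary: u) (auto dest: gen_moves_gens)

lemma basis_act_eq:
  assumes "u \<in> verts F"
  shows "gen_moves g u v \<Longrightarrow> basis_act F \<phi>0 \<phi>1 g u = (basis_elem v :: 'a \<Rightarrow>\<^sub>0 'k::field)"
    and "\<nexists>v. gen_moves g u v \<Longrightarrow> basis_act F \<phi>0 \<phi>1 g u = (0 :: 'a \<Rightarrow>\<^sub>0 'k)"
proof -
  assume v: "gen_moves g u v"
  show "basis_act F \<phi>0 \<phi>1 g u = (basis_elem v :: 'a \<Rightarrow>\<^sub>0 'k)"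
  proof (cases g)
    case (Arc d)
    show ?thesis
    proof (cases d)
      case (Fwd a)
      obtain f where f: "f \<in> out_arcs F u" "\<phi>1 f = a" "head F f = v"
        using v unfolding Arc Fwd gen_moves_Fwd by blast
      show ?thesis unfolding Arc Fwd by (subst basis_act_Fwd[OF f(1)]) (simp add: f)
    next
      case (Rev a)
      obtain f where f: "f \<in> in_arcs F u" "\<phi>1 f = a" "tail F f = v"
        using v unfolding Arc Rev gen_moves_Rev by blast
      show ?thesis unfolding Arc Rev by (subst basis_act_Rev[OF f(1)]) (simp add: f)
    qed
  qed (use v in simp)
next
  assume none: "\<nexists>v. gen_moves g u v"
  show "basis_act F \<phi>0 \<phi>1 g u = (0 :: 'a \<Rightarrow>\<^sub>0 'k)"
  proof (cases g)
    case (Arc d)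
    show ?thesis
    proof (cases d)
      case (Fwd a)
      have "\<nexists>f. f \<in> out_arcs F u \<and> \<phi>1 f = a"
        using none unfolding Arc Fwd gen_moves_Fwd by blast
      then show ?thesis unfolding Arc Fwd basis_act.simps by (rule if_not_P)
    next
      case (Rev a)
      have "\<nexists>f. f \<in> in_arcs F u \<and> \<phi>1 f = a"
        using none unfolding Arc Rev gen_moves_Rev by blast
      then show ?thesis unfolding Arc Rev basis_act.simps by (rule if_not_P)
    qed
  qed (use none assms in simp)
qed

lemma lookup_basis_act:
  assumes "u \<in> verts F"
  shows "Poly_Mapping.lookup (basis_act F \<phi>0 \<phi>1 g u :: 'a \<Rightarrow>\<^sub>0 'k::field) v =
           (if gen_moves g u v then 1 else 0)"
proof (cases "\<exists>z. gen_moves g u z")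
  case True
  then obtain z where z: "gen_moves g u z" ..
  have "basis_act F \<phi>0 \<phi>1 g u = (basis_elem z :: 'a \<Rightarrow>\<^sub>0 'k)"
    by (rule basis_act_eq(1)[OF assms z])
  moreover have "gen_moves g u v \<longleftrightarrow> v = z"
    using z gen_moves_functional by blast
  ultimately show ?thesis
    by (simp add: lookup_single when_def del: basis_act.simps)
next
  case False
  have "basis_act F \<phi>0 \<phi>1 g u = (0 :: 'a \<Rightarrow>\<^sub>0 'k)"
    by (rule basis_act_eq(2)[OF assms False])
  then show ?thesis
    using False by (simp del: basis_act.simps)
qed

text \<open>Moving is injective, so no two terms of \<open>x\<close> can cancel when a word acts: the action
  relabels some of the terms and drops the others. This is what makes supports shrink.\<close>

lemma lookup_word_act:
  assumes "x \<in> rep_module F"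
  shows "word_moves gs u v \<Longrightarrow>
           Poly_Mapping.lookup (word_act F \<phi>0 \<phi>1 x gs) v = (Poly_Mapping.lookup x u :: 'k::field)"
    and "\<nexists>u. word_moves gs u v \<Longrightarrow> Poly_Mapping.lookup (word_act F \<phi>0 \<phi>1 x gs) v = (0 :: 'k)"
proof -
  have "(word_moves gs u v \<longrightarrow>
           Poly_Mapping.lookup (word_act F \<phi>0 \<phi>1 x gs) v = (Poly_Mapping.lookup x u :: 'k)) \<and>
        ((\<nexists>u. word_moves gs u v) \<longrightarrow> Poly_Mapping.lookup (word_act F \<phi>0 \<phi>1 x gs) v = (0 :: 'k))"
    using assms
  proof (induction gs arbitrary: x u)
    case (Cons g gs)
    define y where "y = linear_ext (basis_act F \<phi>0 \<phi>1 g) x"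
    have y: "y \<in> rep_module F"
      using word_act_closed[OF Cons.prems, of "[g]"] by (simp add: y_def)
    have keys: "Poly_Mapping.keys x \<subseteq> verts F"
      using Cons.prems by (simp add: rep_module_def)
    have lookup_y: "Poly_Mapping.lookup y t =
        (\<Sum>s\<in>Poly_Mapping.keys x. if gen_moves g s t then Poly_Mapping.lookup x s else 0)" for t
      unfolding y_def lookup_linear_ext
      by (rule sum.cong) (use keys in \<open>auto simp: lookup_basis_act simp del: basis_act.simps\<close>)
    have moved: "Poly_Mapping.lookup y t = Poly_Mapping.lookup x s" if "gen_moves g s t" for s t
    proof -
      have "gen_moves g s' t \<longleftrightarrow> s' = s" for s'
        using that gen_moves_injective by blast
      then show ?thesis by (simp add: lookup_y sum.delta in_keys_iff)
    qed
    have missed: "Poly_Mapping.lookup y t = 0" if "\<nexists>s. gen_moves g s t" for t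
      using that by (simp add: lookup_y)
    note IH = Cons.IH[OF y]
    show ?case
    proof (intro conjI impI)
      assume "word_moves (g # gs) u v"
      then show "Poly_Mapping.lookup (word_act F \<phi>0 \<phi>1 x (g # gs)) v = Poly_Mapping.lookup x u"
        using IH moved by (auto simp: y_def[symmetric])
    next
      assume none: "\<nexists>u. word_moves (g # gs) u v"
      show "Poly_Mapping.lookup (word_act F \<phi>0 \<phi>1 x (g # gs)) v = 0"
      proof (cases "\<exists>t. word_moves gs t v")
        case True
        then obtain t where t: "word_moves gs t v" ..
        then show ?thesis using none IH[of t] missed[of t] by (auto simp: y_def[symmetric])
      next
        case False
        then show ?thesis using IH by (simp add: y_def[symmetric])
      qed
    qed
  qed auto
  then show "word_moves gs u v \<Longrightarrow>
           Poly_Mapping.lookup (word_act F \<phi>0 \<phi>1 x gs) v = (Poly_Mapping.lookup x u :: 'k)"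
    and "\<nexists>u. word_moves gs u v \<Longrightarrow> Poly_Mapping.lookup (word_act F \<phi>0 \<phi>1 x gs) v = (0 :: 'k)"
    by blast+
qed

lemma keys_word_act:
  assumes "x \<in> rep_module F"
  shows "Poly_Mapping.keys (word_act F \<phi>0 \<phi>1 x gs :: 'a \<Rightarrow>\<^sub>0 'k::field) =
           {v. \<exists>u\<in>Poly_Mapping.keys x. word_moves gs u v}"
proof (intro set_eqI)
  fix v
  show "v \<in> Poly_Mapping.keys (word_act F \<phi>0 \<phi>1 x gs) \<longleftrightarrow>
        v \<in> {v. \<exists>u\<in>Poly_Mapping.keys x. word_moves gs u v}"
  proof (cases "\<exists>u. word_moves gs u v")
    case True
    then obtain u where u: "word_moves gs u v" ..
    then have "word_moves gs u' v \<longleftrightarrow> u' = u" for u' using word_moves_injective by blast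
    then show ?thesis using lookup_word_act(1)[OF assms u] by (simp add: in_keys_iff)
  next
    case False
    then show ?thesis using lookup_word_act(2)[OF assms False] by (simp add: in_keys_iff)
  qed
qed

lemma word_act_basis:
  assumes "u \<in> verts F"
  shows "word_moves gs u v \<Longrightarrow> word_act F \<phi>0 \<phi>1 (basis_elem u) gs = (basis_elem v :: 'a \<Rightarrow>\<^sub>0 'k::field)"
    and "\<nexists>v. word_moves gs u v \<Longrightarrow> word_act F \<phi>0 \<phi>1 (basis_elem u) gs = (0 :: 'a \<Rightarrow>\<^sub>0 'k)"
proof -
  have basis: "(basis_elem u :: 'a \<Rightarrow>\<^sub>0 'k) \<in> rep_module F"
    by (rule rep_module_basis[OF assms])
  assume v: "word_moves gs u v"
  show "word_act F \<phi>0 \<phi>1 (basis_elem u) gs = (basis_elem v :: 'a \<Rightarrow>\<^sub>0 'k)"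
  proof (rule poly_mapping_eqI)
    fix t
    have t: "word_moves gs s t \<Longrightarrow> s = u \<longleftrightarrow> t = v" for s
      using v word_moves_functional word_moves_injective by blast
    show "Poly_Mapping.lookup (word_act F \<phi>0 \<phi>1 (basis_elem u) gs) t =
          Poly_Mapping.lookup (basis_elem v :: 'a \<Rightarrow>\<^sub>0 'k) t"
    proof (cases "\<exists>s. word_moves gs s t")
      case True
      then obtain s where s: "word_moves gs s t" ..
      show ?thesis
        using lookup_word_act(1)[OF basis s] t[OF s] by (auto simp: lookup_single when_def)
    next
      case False
      then show ?thesis
        using lookup_word_act(2)[OF basis False] v by (auto simp: lookup_single when_def)
    qed
  qed
next
  assume "\<nexists>v. word_moves gs u v"
  then have "Poly_Mapping.keys (word_act F \<phi>0 \<phi>1 (basis_elem u) gs :: 'a \<Rightarrow>\<^sub>0 'k) = {}"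
    using keys_word_act[OF rep_module_basis[OF assms], of gs] by auto
  then show "word_act F \<phi>0 \<phi>1 (basis_elem u) gs = (0 :: 'a \<Rightarrow>\<^sub>0 'k)" by simp
qed

lemma word_act_cong:
  assumes "x \<in> rep_module F" and "\<And>u v. word_moves gs u v \<longleftrightarrow> word_moves hs u v"
  shows "word_act F \<phi>0 \<phi>1 x gs = (word_act F \<phi>0 \<phi>1 x hs :: 'a \<Rightarrow>\<^sub>0 'k::field)"
proof (rule poly_mapping_eqI)
  fix v
  show "Poly_Mapping.lookup (word_act F \<phi>0 \<phi>1 x gs) v =
        Poly_Mapping.lookup (word_act F \<phi>0 \<phi>1 x hs) v"
    using lookup_word_act[OF assms(1)] assms(2) by (cases "\<exists>u. word_moves gs u v") metis+
qed


section \<open>Words and paths\<close>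

lemma word_moves_iff_walk:
  assumes "u \<in> verts F"
  shows "word_moves (map Arc es) u v \<longleftrightarrow>
           (\<exists>fs. pre_digraph.awalk (double_graph F) u fs v \<and> es = map (map_darc \<phi>1) fs)"
  using assms
proof (induction es arbitrary: u)
  case Nil
  then show ?case by (auto simp: pre_digraph.awalk_def pre_digraph.cas.simps)
next
  case (Cons d es)
  have walk_Cons: "pre_digraph.awalk (double_graph F) u (f # fs) v \<longleftrightarrow>
      f \<in> arcs (double_graph F) \<and> tail (double_graph F) f = u \<and>
      pre_digraph.awalk (double_graph F) (head (double_graph F) f) fs v" for f fs
    using Cons.prems by (auto simp: pre_digraph.awalk_def pre_digraph.cas.simps)
  have "word_moves (map Arc (d # es)) u v \<longleftrightarrow>
      (\<exists>f\<in>arcs (double_graph F). map_darc \<phi>1 f = d \<and> tail (double_graph F) f = u \<and>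
         word_moves (map Arc es) (head (double_graph F) f) v)"
    by (auto simp: gen_moves.simps(2))
  also have "\<dots> \<longleftrightarrow>
      (\<exists>f\<in>arcs (double_graph F). map_darc \<phi>1 f = d \<and> tail (double_graph F) f = u \<and>
         (\<exists>fs. pre_digraph.awalk (double_graph F) (head (double_graph F) f) fs v \<and>
            es = map (map_darc \<phi>1) fs))"
    by (intro bex_cong refl conj_cong Cons.IH) auto
  also have "\<dots> \<longleftrightarrow> (\<exists>fs. pre_digraph.awalk (double_graph F) u fs v \<and>
      d # es = map (map_darc \<phi>1) fs)"
    unfolding Cons_eq_map_conv using walk_Cons by blast
  finally show ?case .
qed

lemma paths_between_nonempty_iff:
  assumes "u \<in> verts F"
  shows "paths_between (double_graph F) u v \<noteq> {} \<longleftrightarrow> (\<exists>es. word_moves (map Arc es) u v)"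
  unfolding word_moves_iff_walk[OF assms] paths_between_def by blast

text \<open>Irreducibility speaks of images of paths; this turns it into a statement about which words
  move a vertex.\<close>

lemma path_map_paths_from:
  assumes "u \<in> verts F"
  shows "path_map \<phi>0 \<phi>1 ` paths_from (double_graph F) u =
           {(\<phi>0 u, es) |es. \<exists>v. word_moves (map Arc es) u v}"
proof (intro equalityI subsetI)
  fix p assume "p \<in> path_map \<phi>0 \<phi>1 ` paths_from (double_graph F) u"
  then show "p \<in> {(\<phi>0 u, es) |es. \<exists>v. word_moves (map Arc es) u v}"
    unfolding word_moves_iff_walk[OF assms]
    by (auto simp: path_map_def paths_from_def paths_between_def)
next
  fix p assume "p \<in> {(\<phi>0 u, es) |es. \<exists>v. word_moves (map Arc es) u v}"
  then obtain es v where p: "p = (\<phi>0 u, es)" "word_moves (map Arc es) u v" by blast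
  obtain fs where fs: "pre_digraph.awalk (double_graph F) u fs v" "es = map (map_darc \<phi>1) fs"
    using p(2) unfolding word_moves_iff_walk[OF assms] by blast
  have "(u, fs) \<in> paths_from (double_graph F) u"
    using fs(1) word_moves_verts[OF p(2) assms]
    by (auto simp: paths_from_def paths_between_def)
  moreover have "p = path_map \<phi>0 \<phi>1 (u, fs)"
    by (simp add: p(1) fs(2) path_map_def)
  ultimately show "p \<in> path_map \<phi>0 \<phi>1 ` paths_from (double_graph F) u" by blast
qed

lemma word_moves_path:
  assumes "word_moves (map Arc es) u v" "u \<in> verts F"
  shows "(\<phi>0 u, es) \<in> paths (double_graph (hat_graph E w))"
proof -
  have "pre_digraph.cas (double_graph (hat_graph E w)) (\<phi>0 u) es (\<phi>0 v) \<and>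
        set es \<subseteq> arcs (double_graph (hat_graph E w))"
    using assms
  proof (induction es arbitrary: u)
    case (Cons d es)
    then obtain z where z: "gen_moves (Arc d) u z" "word_moves (map Arc es) z v"
      by auto
    then show ?case
      using Cons.IH[OF z(2)] gen_moves_verts[OF z(1)] gen_moves_Arc_ends[OF z(1)]
      by (simp add: pre_digraph.cas.simps del: double_graph_simps)
  qed (simp add: pre_digraph.cas.simps)
  then have "pre_digraph.awalk (double_graph (hat_graph E w)) (\<phi>0 u) es (\<phi>0 v)"
    using vert_props assms(2) by (simp add: pre_digraph.awalk_def)
  then show ?thesis
    using vert_props assms word_moves_verts
    by (fastforce simp: paths_def paths_from_def paths_between_def)
qed

lemma word_moves_same_start:
  assumes "gs \<noteq> []" "word_moves gs u v" "word_moves gs u' v'"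
  shows "\<phi>0 u = \<phi>0 u'"
proof -
  obtain g hs z z' where "gen_moves g u z" "gen_moves g u' z'"
    using assms by (cases gs) auto
  then show ?thesis
    using gen_moves_Arc_ends(2) by (cases g) (simp, metis)
qed

lemma word_moves_arcs:
  assumes "word_moves gs u v"
  shows "word_moves (map Arc (word_arcs gs)) u v"
  using assms by (induction gs arbitrary: u rule: word_arcs.induct) auto

text \<open>The labels of the vertices that a lift visits depend only on the label of its start and on the
  arcs of the word. Therefore the vertex letters of a word constrain a lift only through the label
  of its start.\<close>

lemma word_moves_if_arcs:
  assumes "word_moves gs u v" "u' \<in> verts F" "\<phi>0 u' = \<phi>0 u" "word_moves (map Arc (word_arcs gs)) u' v'"
  shows "word_moves gs u' v'"
  using assms
proof (induction gs arbitrary: u u' rule: word_arcs.induct)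
  case (3 d gs)
  obtain z where z: "gen_moves (Arc d) u z" "word_moves gs z v"
    using "3.prems"(1) by auto
  obtain z' where z': "gen_moves (Arc d) u' z'" "word_moves (map Arc (word_arcs gs)) z' v'"
    using "3.prems"(4) by auto
  have "word_moves gs z' v'"
    using "3.IH"[OF z(2) _ _ z'(2)] gen_moves_verts[OF z'(1)]
      gen_moves_Arc_ends(3)[OF z(1)] gen_moves_Arc_ends(3)[OF z'(1)] by simp
  then show ?case using z'(1) by auto
qed auto

lemma word_moves_path_word:
  assumes "u \<in> verts F"
  shows "word_moves (path_word (\<phi>0 u, es)) u v \<longleftrightarrow> word_moves (map Arc es) u v"
  using assms by (cases es) auto

lemma word_moves_as_path:
  assumes "gs \<noteq> []" "word_moves gs u v" "u \<in> verts F"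
  shows "word_moves gs u' v' \<longleftrightarrow> word_moves (path_word (\<phi>0 u, word_arcs gs)) u' v'"
proof -
  have char: "word_moves hs u' v' \<longleftrightarrow>
      u' \<in> verts F \<and> \<phi>0 u' = \<phi>0 u \<and> word_moves (map Arc (word_arcs hs)) u' v'"
    if hs: "hs \<noteq> []" "word_moves hs u v" for hs
  proof -
    have "u' \<in> verts F" if "word_moves hs u' v'"
      using that hs(1) gen_moves_verts by (cases hs) auto
    then show ?thesis
      using word_moves_arcs word_moves_if_arcs[OF hs(2)] word_moves_same_start[OF hs] by metis
  qed
  have "word_moves (path_word (\<phi>0 u, word_arcs gs)) u v"
    unfolding word_moves_path_word[OF assms(3)] by (rule word_moves_arcs[OF assms(2)])
  then show ?thesis
    using char[OF assms(1,2)] char[of "path_word (\<phi>0 u, word_arcs gs)"] by simp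
qed

text \<open>The path starts at the label of a vertex that the word moves, and its arcs are those of the
  word. This allows composing operators by concatenating words, without regard to whether the
  corresponding paths can be composed.\<close>

lemma word_acts_as_path:
  assumes "gs \<noteq> []" "x \<in> rep_module F" "word_act F \<phi>0 \<phi>1 x gs \<noteq> (0 :: 'a \<Rightarrow>\<^sub>0 'k::field)"
  obtains p where "p \<in> paths (double_graph (hat_graph E w))"
    "word_act F \<phi>0 \<phi>1 x gs = word_act F \<phi>0 \<phi>1 x (path_word p)"
proof -
  have "Poly_Mapping.keys (word_act F \<phi>0 \<phi>1 x gs) \<noteq> {}" using assms(3) by simp
  then obtain u v where uv: "u \<in> Poly_Mapping.keys x" "word_moves gs u v"
    unfolding keys_word_act[OF assms(2)] by blast
  have u: "u \<in> verts F" using uv(1) assms(2) by (auto simp: rep_module_def)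
  have "word_act F \<phi>0 \<phi>1 x gs = word_act F \<phi>0 \<phi>1 x (path_word (\<phi>0 u, word_arcs gs))"
    by (rule word_act_cong[OF assms(2) word_moves_as_path[OF assms(1) uv(2) u]])
  with word_moves_path[OF word_moves_arcs[OF uv(2)] u] show ?thesis by (rule that)
qed


section \<open>Shrinking supports\<close>

lemma distinct_path_sets_separate:
  assumes "u \<in> verts F" "v \<in> verts F"
    and "\<not> path_map \<phi>0 \<phi>1 ` paths_from (double_graph F) u \<subseteq>
           path_map \<phi>0 \<phi>1 ` paths_from (double_graph F) v"
  obtains gs where "gs \<noteq> []" "\<exists>t. word_moves gs u t" "\<nexists>t. word_moves gs v t"
proof -
  obtain es t where es: "word_moves (map Arc es) u t"
    "(\<phi>0 u, es) \<notin> {(\<phi>0 v, es) |es. \<exists>t. word_moves (map Arc es) v t}"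
    using assms(3) unfolding path_map_paths_from[OF assms(1)] path_map_paths_from[OF assms(2)]
    by blast
  \<comment> \<open>The letter for the start vertex covers both reasons for not having the path: \<open>v\<close> may carry
    another label, or the arcs may not lift.\<close>
  show ?thesis
  proof (rule that)
    show "\<exists>t. word_moves (Vert (\<phi>0 u) # map Arc es) u t"
      using es(1) assms(1) by auto
    show "\<nexists>t. word_moves (Vert (\<phi>0 u) # map Arc es) v t"
      using es(2) by auto
  qed simp
qed

text \<open>A word that moves one vertex of the support of \<open>x\<close> but not another one produces a nonzero
  vector of smaller support. As no two vertices of an irreducible representation graph have the
  same paths, this can be repeated until a single vertex is left.\<close>

lemma irreducible_reaches_vertex:
  fixes x :: "'a \<Rightarrow>\<^sub>0 'k::field"
  assumes irreducible: "irreducible_representation_graph E w F \<phi>0 \<phi>1"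
    and "x \<in> rep_module F" "x \<noteq> 0"
  obtains gs v c where "gs \<noteq> []" "v \<in> verts F" "c \<noteq> 0"
    "word_act F \<phi>0 \<phi>1 x gs = Poly_Mapping.single v c"
proof -
  have "\<exists>gs v c. gs \<noteq> [] \<and> v \<in> verts F \<and> c \<noteq> 0 \<and>
          word_act F \<phi>0 \<phi>1 x gs = Poly_Mapping.single v c"
    using assms(2,3)
  proof (induction "card (Poly_Mapping.keys x)" arbitrary: x rule: less_induct)
    case less
    have verts: "Poly_Mapping.keys x \<subseteq> verts F"
      using less.prems(1) by (simp add: rep_module_def)
    obtain u where u: "u \<in> Poly_Mapping.keys x"
      using less.prems(2) by fastforce
    show ?case
    proof (cases "Poly_Mapping.keys x = {u}")
      case True
      have "x = Poly_Mapping.single u (Poly_Mapping.lookup x u)"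
        using True by (intro poly_mapping_eqI) (auto simp: lookup_single when_def in_keys_iff set_eq_iff)
      then have "word_act F \<phi>0 \<phi>1 x [Vert (\<phi>0 u)] = Poly_Mapping.single u (Poly_Mapping.lookup x u)"
        by (metis (no_types, lifting) basis_act.simps(1) linear_ext_single mult.right_neutral
            pm_scale_single word_act_Cons word_act_Nil)
      with u verts show ?thesis by (metis in_keys_iff list.distinct(2) subsetD)
    next
      case False
      then obtain v where v: "v \<in> Poly_Mapping.keys x" "v \<noteq> u" using u by blast
      have "path_map \<phi>0 \<phi>1 ` paths_from (double_graph F) u \<noteq>
            path_map \<phi>0 \<phi>1 ` paths_from (double_graph F) v"
        using irreducible u v verts
        unfolding irreducible_representation_graph_def by (metis subsetD)
      then obtain s t where st: "s \<in> Poly_Mapping.keys x" "t \<in> Poly_Mapping.keys x"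
        "\<not> path_map \<phi>0 \<phi>1 ` paths_from (double_graph F) s \<subseteq>
           path_map \<phi>0 \<phi>1 ` paths_from (double_graph F) t"
        using u v(1) by (metis subset_antisym)
      have "s \<in> verts F" "t \<in> verts F" using st(1,2) verts by blast+
      then obtain gs where gs: "gs \<noteq> []" "\<exists>z. word_moves gs s z" "\<nexists>z. word_moves gs t z"
        by (rule distinct_path_sets_separate[OF _ _ st(3)])
      define y where "y = word_act F \<phi>0 \<phi>1 x gs"
      have y: "y \<in> rep_module F"
        unfolding y_def by (rule word_act_closed[OF less.prems(1)])
      have keys_y: "Poly_Mapping.keys y = {z. \<exists>r\<in>Poly_Mapping.keys x. word_moves gs r z}"
        unfolding y_def by (rule keys_word_act[OF less.prems(1)])
      have "Poly_Mapping.keys y \<noteq> {}"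
        using st(1) gs(2) unfolding keys_y by blast
      then have "y \<noteq> 0" by auto
      have "\<forall>z\<in>Poly_Mapping.keys y. \<exists>r. r \<in> Poly_Mapping.keys x \<and> word_moves gs r z"
        unfolding keys_y by blast
      then obtain origin where origin: "\<forall>z\<in>Poly_Mapping.keys y.
          origin z \<in> Poly_Mapping.keys x \<and> word_moves gs (origin z) z"
        unfolding bchoice_iff by blast
      \<comment> \<open>Tracing the terms of \<open>y\<close> back along \<open>gs\<close> embeds its support into that of \<open>x\<close>, and \<open>t\<close> is
        missed.\<close>
      have "card (Poly_Mapping.keys y) \<le> card (Poly_Mapping.keys x - {t})"
      proof (rule card_inj_on_le)
        show "inj_on origin (Poly_Mapping.keys y)"
        proof (rule inj_onI)
          fix z z' assume z: "z \<in> Poly_Mapping.keys y" "z' \<in> Poly_Mapping.keys y" "origin z = origin z'"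
          then have "word_moves gs (origin z) z" "word_moves gs (origin z) z'"
            using origin by auto
          then show "z = z'" by (rule word_moves_functional)
        qed
        show "origin ` Poly_Mapping.keys y \<subseteq> Poly_Mapping.keys x - {t}"
          using origin gs(3) by blast
      qed simp
      also have "\<dots> < card (Poly_Mapping.keys x)"
        by (rule card_Diff1_less) (use st(2) in simp_all)
      finally obtain hs v c where "hs \<noteq> []" "v \<in> verts F" "c \<noteq> 0"
        "word_act F \<phi>0 \<phi>1 y hs = Poly_Mapping.single v c"
        using less.hyps[OF _ y \<open>y \<noteq> 0\<close>] by blast
      moreover have "word_act F \<phi>0 \<phi>1 y hs = word_act F \<phi>0 \<phi>1 x (gs @ hs)"
        by (simp add: y_def word_act_append)
      ultimately show ?thesis using gs(1) by (metis append_is_Nil_conv)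
    qed
  qed
  with that show ?thesis by blast
qed


section \<open>Vertices with the same paths\<close>

text \<open>As lifts are unique, the paths of \<open>u\<close> that begin with an arc \<open>d\<close> are \<open>d\<close> followed by the paths
  of the vertex to which \<open>d\<close> moves \<open>u\<close>. Hence having the same paths is a bisimulation.\<close>

lemma same_paths_gen_moves:
  assumes "u \<in> verts F" "v \<in> verts F"
    and same: "path_map \<phi>0 \<phi>1 ` paths_from (double_graph F) u =
               path_map \<phi>0 \<phi>1 ` paths_from (double_graph F) v"
    and u': "gen_moves g u u'"
  obtains v' where "gen_moves g v v'"
    "path_map \<phi>0 \<phi>1 ` paths_from (double_graph F) u' =
     path_map \<phi>0 \<phi>1 ` paths_from (double_graph F) v'"
proof -
  have "(\<phi>0 u, []) \<in> path_map \<phi>0 \<phi>1 ` paths_from (double_graph F) u"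
    unfolding path_map_paths_from[OF assms(1)] by (auto intro!: exI[of _ u])
  then have start: "\<phi>0 u = \<phi>0 v"
    unfolding same path_map_paths_from[OF assms(2)] by simp
  have liftable: "(\<exists>t. word_moves (map Arc es) u t) \<longleftrightarrow> (\<exists>t. word_moves (map Arc es) v t)" for es
  proof -
    have "(\<phi>0 u, es) \<in> path_map \<phi>0 \<phi>1 ` paths_from (double_graph F) u \<longleftrightarrow>
          (\<phi>0 u, es) \<in> path_map \<phi>0 \<phi>1 ` paths_from (double_graph F) v"
      by (simp only: same)
    then show ?thesis
      unfolding path_map_paths_from[OF assms(1)] path_map_paths_from[OF assms(2)]
      using start by auto
  qed
  show ?thesis
  proof (cases g)
    case (Vert a)
    then show ?thesis using u' assms(2) same start by (intro that[of v]) auto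
  next
    case (Arc d)
    have step: "gen_moves (Arc d) u u'" using u' Arc by simp
    then have "\<exists>t. word_moves (map Arc [d]) u t" by auto
    then have "\<exists>t. word_moves (map Arc [d]) v t" unfolding liftable .
    then obtain v' where v': "gen_moves (Arc d) v v'" by auto
    have verts: "u' \<in> verts F" "v' \<in> verts F"
      using gen_moves_verts[OF step] gen_moves_verts[OF v'] by simp_all
    have tails: "word_moves (map Arc (d # es)) r t \<longleftrightarrow> word_moves (map Arc es) r' t"
      if r: "gen_moves (Arc d) r r'" for r r' t es
    proof -
      have "gen_moves (Arc d) r z \<longleftrightarrow> z = r'" for z
        using r gen_moves_functional by blast
      then show ?thesis by simp
    qed
    have "(\<exists>t. word_moves (map Arc es) u' t) \<longleftrightarrow> (\<exists>t. word_moves (map Arc es) v' t)" for es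
      using liftable[of "d # es"] by (simp only: tails[OF step] tails[OF v'])
    moreover have "\<phi>0 u' = \<phi>0 v'"
      using gen_moves_Arc_ends(3)[OF step] gen_moves_Arc_ends(3)[OF v'] by simp
    ultimately show ?thesis
      using v' Arc by (intro that[of v']) (simp_all add: path_map_paths_from verts)
  qed
qed

lemma same_paths_word_moves:
  assumes "u \<in> verts F" "v \<in> verts F"
    and "path_map \<phi>0 \<phi>1 ` paths_from (double_graph F) u =
         path_map \<phi>0 \<phi>1 ` paths_from (double_graph F) v"
    and "word_moves gs u u'"
  shows "\<exists>v'. word_moves gs v v'"
  using assms
proof (induction gs arbitrary: u v)
  case (Cons g gs)
  obtain z where z: "gen_moves g u z" "word_moves gs z u'"
    using Cons.prems(4) by auto
  obtain z' where "gen_moves g v z'"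
    "path_map \<phi>0 \<phi>1 ` paths_from (double_graph F) z =
     path_map \<phi>0 \<phi>1 ` paths_from (double_graph F) z'"
    by (rule same_paths_gen_moves[OF Cons.prems(1-3) z(1)])
  then show ?case
    using Cons.IH[of z z'] z gen_moves_verts by (metis word_moves.simps(2))
qed (auto intro!: exI)

end

text \<open>Written as a linear extension so that linearity is inherited from \<open>linear_ext\<close>; the one-element
  type stands for the field as a one-dimensional space.\<close>

definition coeff_sum :: "('a \<Rightarrow>\<^sub>0 'k::field) \<Rightarrow> 'k" where
  "coeff_sum x = Poly_Mapping.lookup (linear_ext (\<lambda>_. Poly_Mapping.single () 1) x) ()"

lemma coeff_sum_diff: "coeff_sum (x - y) = coeff_sum x - coeff_sum y"
  by (simp add: coeff_sum_def linear_ext_diff lookup_minus)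

lemma coeff_sum_scale: "coeff_sum (pm_scale c x) = c * coeff_sum x"
  by (simp add: coeff_sum_def linear_ext_scale)

lemma coeff_sum_sum: "coeff_sum (sum f S) = (\<Sum>i\<in>S. coeff_sum (f i))"
  by (simp add: coeff_sum_def linear_ext_sum lookup_sum)

lemma coeff_sum_single [simp]: "coeff_sum (Poly_Mapping.single v c) = c"
  by (simp add: coeff_sum_def)

lemma coeff_sum_zero [simp]: "coeff_sum 0 = 0"
  by (simp add: coeff_sum_def)

context representation_graph
begin

lemma word_act_diff:
  "word_act F \<phi>0 \<phi>1 (x - y) gs = word_act F \<phi>0 \<phi>1 x gs - word_act F \<phi>0 \<phi>1 y gs"
  using word_act_add[of F \<phi>0 \<phi>1 "x - y" y gs] by simp

text \<open>Two vertices with the same paths are moved or annihilated together by each word. So all of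
  \<open>(u - v) \<cdot> L\<close> lies in the kernel of the sum of the coefficients, which contains no vertex.\<close>

lemma coeff_sum_same_paths:
  fixes p :: "('v, 'e, 'k::field) free_elem"
  assumes "u \<in> verts F" "v \<in> verts F"
    and same: "path_map \<phi>0 \<phi>1 ` paths_from (double_graph F) u =
               path_map \<phi>0 \<phi>1 ` paths_from (double_graph F) v"
  shows "coeff_sum (free_act F \<phi>0 \<phi>1 (basis_elem u - basis_elem v) p) = 0"
proof -
  have "coeff_sum (word_act F \<phi>0 \<phi>1 (basis_elem u - basis_elem v :: 'a \<Rightarrow>\<^sub>0 'k) gs) = 0" for gs
  proof (cases "\<exists>t. word_moves gs u t")
    case True
    then obtain s t where "word_moves gs u s" "word_moves gs v t"
      using same_paths_word_moves[OF assms] by blast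
    then show ?thesis
      by (simp add: word_act_diff coeff_sum_diff word_act_basis(1)[OF assms(1)]
          word_act_basis(1)[OF assms(2)])
  next
    case False
    then have "\<nexists>t. word_moves gs v t"
      using same_paths_word_moves[OF assms(2,1) same[symmetric]] by blast
    with False show ?thesis
      by (simp add: word_act_diff word_act_basis(2)[OF assms(1)] word_act_basis(2)[OF assms(2)])
  qed
  then show ?thesis
    by (simp add: free_act_def linear_ext_def coeff_sum_sum coeff_sum_scale)
qed


section \<open>Simplicity\<close>

lemma single_free_algebra: "gs \<noteq> [] \<Longrightarrow> set gs \<subseteq> X \<Longrightarrow> Poly_Mapping.single (FWord gs) c \<in> free_algebra X"
  by (simp add: free_algebra_def)

lemma rep_act_word:
  assumes "x \<in> rep_module F" "gs \<noteq> []" "set gs \<subseteq> gens E w"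
  shows "rep_act F \<phi>0 \<phi>1 x (wlpa_class E w (Poly_Mapping.single (FWord gs) c)) =
           pm_scale c (word_act F \<phi>0 \<phi>1 x gs)"
  using rep_act_class[OF assms(1) single_free_algebra[OF assms(2,3)]] by simp

lemma path_word_gens:
  assumes "p \<in> paths (double_graph (hat_graph E w))"
  shows "set (path_word p) \<subseteq> gens E w"
proof -
  obtain a es b where p: "p = (a, es)" "pre_digraph.awalk (double_graph (hat_graph E w)) a es b"
    using assms by (auto simp: paths_def paths_from_def paths_between_def simp del: double_graph_simps)
  then show ?thesis
    by (cases es) (auto simp: pre_digraph.awalk_def gens_def simp del: double_graph_simps(2))
qed

lemma rep_act_path_monomial:
  assumes "x \<in> rep_module F" "p \<in> paths (double_graph (hat_graph E w))"
  shows "rep_act F \<phi>0 \<phi>1 x (nscale (wlpa E w) c (path_monomial E w p)) =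
           pm_scale c (word_act F \<phi>0 \<phi>1 x (path_word p))"
  using assms
  by (simp add: path_monomial_def wlpa_nscale rep_act_word path_word_gens single_free_algebra)

lemma path_monomial_carr:
  assumes "p \<in> paths (double_graph (hat_graph E w))"
  shows "nscale (wlpa E w) c (path_monomial E w p) \<in> carr (wlpa E w)"
  unfolding path_monomial_def
  using assms by (simp add: wlpa_nscale wlpa_class_carr path_word_gens single_free_algebra)

text \<open>The label of a vertex in the support of \<open>x\<close> keeps that vertex; this replaces a unit, which the
  algebra need not have.\<close>

lemma rep_act_vertex:
  fixes x :: "'a \<Rightarrow>\<^sub>0 'k::field"
  assumes "x \<in> rep_module F" "u \<in> Poly_Mapping.keys x"
  shows "\<exists>a\<in>carr (wlpa E w). rep_act F \<phi>0 \<phi>1 x a \<noteq> 0"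
proof -
  have u: "u \<in> verts F" using assms by (auto simp: rep_module_def)
  then have gens: "set [Vert (\<phi>0 u)] \<subseteq> gens E w" using vert_props by (simp add: gens_def)
  have "u \<in> Poly_Mapping.keys (word_act F \<phi>0 \<phi>1 x [Vert (\<phi>0 u)])"
    unfolding keys_word_act[OF assms(1)] using assms(2) u by auto
  then have "rep_act F \<phi>0 \<phi>1 x (wlpa_class E w (Poly_Mapping.single (FWord [Vert (\<phi>0 u)]) 1)) \<noteq> 0"
    unfolding rep_act_word[OF assms(1) list.distinct(2) gens] by auto
  then show ?thesis
    using wlpa_class_carr[OF single_free_algebra[OF list.distinct(2) gens]] by blast
qed

text \<open>A nonzero coefficient at \<open>v\<close> must come from one of the words of a representative of \<open>a\<close>, and the
  lift of that word is a path to \<open>v\<close>.\<close>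

lemma reachable_if_rep_act:
  assumes "u \<in> verts F" "a \<in> carr (wlpa E w)"
    and "rep_act F \<phi>0 \<phi>1 (basis_elem u) a = (basis_elem v :: 'a \<Rightarrow>\<^sub>0 'k::field)"
  shows "paths_between (double_graph F) u v \<noteq> {}"
proof -
  obtain p where p: "p \<in> free_algebra (gens E w)" "a = wlpa_class E w p"
    using assms(2) by (rule wlpa_carrE)
  have "Poly_Mapping.lookup (free_act F \<phi>0 \<phi>1 (basis_elem u) p) v \<noteq> 0"
    using assms(3) rep_act_class[OF rep_module_basis[OF assms(1)] p(1)] p(2) by simp
  then obtain g where
    "Poly_Mapping.lookup (word_act F \<phi>0 \<phi>1 (basis_elem u :: 'a \<Rightarrow>\<^sub>0 'k) (letters g)) v \<noteq> 0"
    unfolding free_act_def lookup_linear_ext by (metis (no_types, lifting) mult_zero_right sum.neutral)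
  then have "v \<in> Poly_Mapping.keys (word_act F \<phi>0 \<phi>1 (basis_elem u :: 'a \<Rightarrow>\<^sub>0 'k) (letters g))"
    by (simp add: in_keys_iff)
  then have "word_moves (letters g) u v"
    unfolding keys_word_act[OF rep_module_basis[OF assms(1)]] by simp
  then show ?thesis
    using word_moves_arcs paths_between_nonempty_iff[OF assms(1)] by blast
qed

text \<open>The submodule \<open>x \<cdot> L\<close> is not zero, so in a simple module it is everything.\<close>

lemma simple_reaches_all_vertices:
  assumes "simple_right_module (wlpa E w) (rep_module F :: ('a \<Rightarrow>\<^sub>0 'k::field) set) (rep_act F \<phi>0 \<phi>1)"
    and x: "x \<in> rep_module F" "(x :: 'a \<Rightarrow>\<^sub>0 'k) \<noteq> 0" and v: "v \<in> verts F"
  shows "\<exists>a\<in>carr (wlpa E w). rep_act F \<phi>0 \<phi>1 x a = basis_elem v"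
proof -
  interpret right_module "wlpa E w :: ('k, ('v, 'e, 'k) wlpa_elem) nualg" "rep_module F"
    "rep_act F \<phi>0 \<phi>1"
    by (rule right_module_rep)
  let ?L = "wlpa E w :: ('k, ('v, 'e, 'k) wlpa_elem) nualg"
  define U where "U = rep_act F \<phi>0 \<phi>1 x ` carr ?L"
  have "right_submodule ?L (rep_module F) (rep_act F \<phi>0 \<phi>1) U"
    unfolding right_submodule_def additive_subgroup_def
  proof (intro conjI ballI)
    have "rep_act F \<phi>0 \<phi>1 x (nzero ?L) = 0"
      using x(1) by (simp add: wlpa_nzero rep_act_class free_algebra_zero)
    then show "0 \<in> U" using zero_closed by (force simp: U_def)
    show "y + z \<in> U" if yz: "y \<in> U" "z \<in> U" for y z
    proof -
      obtain a b where "a \<in> carr ?L" "b \<in> carr ?L"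
        "y = rep_act F \<phi>0 \<phi>1 x a" "z = rep_act F \<phi>0 \<phi>1 x b"
        using yz by (auto simp: U_def)
      then show ?thesis
        using act_add_right[OF x(1), of a b] add_closed[of a b] by (force simp: U_def)
    qed
    show "- y \<in> U" if y: "y \<in> U" for y
    proof -
      obtain a where a: "a \<in> carr ?L" "y = rep_act F \<phi>0 \<phi>1 x a" using y by (auto simp: U_def)
      have "- y = rep_act F \<phi>0 \<phi>1 x (nscale ?L (-1) a)"
        using rep_act_scale(1)[OF x(1) a(1), of "-1"] a(2) by simp
      then show ?thesis using scale_closed[OF a(1)] by (auto simp: U_def)
    qed
    show "U \<subseteq> rep_module F" using act_closed[OF x(1)] by (auto simp: U_def)
    show "rep_act F \<phi>0 \<phi>1 y a \<in> U" if y: "y \<in> U" and a: "a \<in> carr ?L" for y a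
    proof -
      obtain b where "b \<in> carr ?L" "y = rep_act F \<phi>0 \<phi>1 x b"
        using y by (auto simp: U_def)
      then show ?thesis
        using act_mult[OF x(1), of b a] mult_closed[of b a] a by (force simp: U_def)
    qed
  qed
  then have "U = {0} \<or> U = rep_module F"
    using assms(1) unfolding simple_right_module_def by blast
  moreover have "U \<noteq> {0}"
  proof -
    obtain u where "u \<in> Poly_Mapping.keys x" using x(2) by fastforce
    then show ?thesis using rep_act_vertex[OF x(1)] unfolding U_def by blast
  qed
  ultimately have "basis_elem v \<in> U" using rep_module_basis[OF v] by blast
  then show ?thesis by (force simp: U_def)
qed

text \<open>Once a submodule contains one vertex, connectedness gives it all vertices, and with the
  scalars all of the module.\<close>

lemma simple_if_connected_and_reaching:
  assumes connected: "connected_graph F" and "verts F \<noteq> {}"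
    and reach: "\<And>x :: 'a \<Rightarrow>\<^sub>0 'k::field. x \<in> rep_module F \<Longrightarrow> x \<noteq> 0 \<Longrightarrow>
      \<exists>a\<in>carr (wlpa E w). rep_act F \<phi>0 \<phi>1 x a \<in> basis_elem ` verts F"
  shows "simple_right_module (wlpa E w) (rep_module F :: ('a \<Rightarrow>\<^sub>0 'k) set) (rep_act F \<phi>0 \<phi>1)"
  unfolding simple_right_module_def
proof (intro conjI allI impI)
  let ?L = "wlpa E w :: ('k, ('v, 'e, 'k) wlpa_elem) nualg"
  show "right_module ?L (rep_module F) (rep_act F \<phi>0 \<phi>1)" by (rule right_module_rep)
  obtain u where u: "u \<in> verts F" using assms(2) by blast
  have "(basis_elem u :: 'a \<Rightarrow>\<^sub>0 'k) \<in> rep_module F" by (rule rep_module_basis[OF u])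
  then show "\<exists>x\<in>rep_module F. \<exists>a\<in>carr ?L. rep_act F \<phi>0 \<phi>1 x a \<noteq> 0"
    using rep_act_vertex[of "basis_elem u :: 'a \<Rightarrow>\<^sub>0 'k" u] by auto
  fix U :: "('a \<Rightarrow>\<^sub>0 'k) set"
  assume "right_submodule ?L (rep_module F) (rep_act F \<phi>0 \<phi>1) U"
  then have U: "0 \<in> U" "\<And>x y. x \<in> U \<Longrightarrow> y \<in> U \<Longrightarrow> x + y \<in> U" "U \<subseteq> rep_module F"
    "\<And>x a. x \<in> U \<Longrightarrow> a \<in> carr ?L \<Longrightarrow> rep_act F \<phi>0 \<phi>1 x a \<in> U"
    by (auto simp: right_submodule_def additive_subgroup_def)
  show "U = {0} \<or> U = rep_module F"
  proof (cases "U = {0}")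
    case False
    then obtain x where x: "x \<in> U" "x \<noteq> 0" using U(1) by blast
    then obtain v where v: "v \<in> verts F" "basis_elem v \<in> U"
      using reach[of x] U(3,4) by fastforce
    have multiples: "Poly_Mapping.single t c \<in> U" if t: "t \<in> verts F" for t c
    proof -
      obtain es where "word_moves (map Arc es) v t"
        using connected v(1) t paths_between_nonempty_iff[OF v(1)]
        unfolding connected_graph_def by blast
      \<comment> \<open>If \<open>t = v\<close>, the list \<open>es\<close> may be empty, but the algebra has no empty word.\<close>
      then have moves: "word_moves (Vert (\<phi>0 v) # map Arc es) v t"
        using v(1) by simp
      let ?a = "wlpa_class E w (Poly_Mapping.single (FWord (Vert (\<phi>0 v) # map Arc es)) c)"
      have "rep_act F \<phi>0 \<phi>1 (basis_elem v) ?a = Poly_Mapping.single t c"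
        unfolding rep_act_word[OF rep_module_basis[OF v(1)] list.distinct(2) word_moves_gens[OF moves]]
          word_act_basis(1)[OF v(1) moves]
        by simp
      moreover have "?a \<in> carr ?L"
        by (rule wlpa_class_carr[OF single_free_algebra[OF list.distinct(2) word_moves_gens[OF moves]]])
      ultimately show ?thesis using U(4)[OF v(2)] by metis
    qed
    have "y \<in> U" if "y \<in> rep_module F" for y
    proof -
      have "(\<Sum>t\<in>S. Poly_Mapping.single t (Poly_Mapping.lookup y t)) \<in> U"
        if "finite S" "S \<subseteq> verts F" for S
        using that by (induction S) (auto intro: U(1,2) multiples)
      moreover have "y = (\<Sum>t\<in>Poly_Mapping.keys y. Poly_Mapping.single t (Poly_Mapping.lookup y t))"
        by (rule poly_mapping_eqI) (auto simp: lookup_sum lookup_single when_def in_keys_iff)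
      ultimately show ?thesis
        using \<open>y \<in> rep_module F\<close> by (metis finite_keys mem_Collect_eq rep_module_def)
    qed
    then show ?thesis using U(3) by blast
  qed simp
qed

end

theorem theorem28:
  fixes E :: "('v, 'e) pre_digraph" and w :: "'e \<Rightarrow> nat"
    and F :: "('a, 'b) pre_digraph" and \<phi>0 :: "'a \<Rightarrow> 'v" and \<phi>1 :: "'b \<Rightarrow> 'e \<times> nat"
    and L :: "('k::field, ('v, 'e, 'k) wlpa_elem) nualg" and V :: "('a \<Rightarrow>\<^sub>0 'k) set"
    and act :: "('a \<Rightarrow>\<^sub>0 'k) \<Rightarrow> ('v, 'e, 'k) wlpa_elem \<Rightarrow> ('a \<Rightarrow>\<^sub>0 'k)"
  defines "L \<equiv> wlpa E w" and "V \<equiv> rep_module F" and "act \<equiv> rep_act F \<phi>0 \<phi>1"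
  assumes "weighted_graph E w"
    and "representation_graph E w F \<phi>0 \<phi>1"
    and "verts F \<noteq> {}"
  shows "(simple_right_module L V act
            \<longleftrightarrow> connected_graph F \<and>
                (\<forall>x\<in>V - {0}. \<exists>a\<in>carr L. act x a \<in> basis_elem ` verts F)) \<and>
         (connected_graph F \<and>
          (\<forall>x\<in>V - {0}. \<exists>a\<in>carr L. act x a \<in> basis_elem ` verts F)
            \<longleftrightarrow> connected_graph F \<and>
                (\<forall>x\<in>V - {0}. \<exists>k. \<exists>p\<in>paths (double_graph (hat_graph E w)).
                   act x (nscale L k (path_monomial E w p)) \<in> basis_elem ` verts F)) \<and>
         (connected_graph F \<and>
          (\<forall>x\<in>V - {0}. \<exists>k. \<exists>p\<in>paths (double_graph (hat_graph E w)).
             act x (nscale L k (path_monomial E w p)) \<in> basis_elem ` verts F)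
            \<longleftrightarrow> irreducible_representation_graph E w F \<phi>0 \<phi>1)"
proof -
  interpret representation_graph E w F \<phi>0 \<phi>1 by (rule assms(5))
  let ?spans = "\<forall>x\<in>V - {0}. \<exists>a\<in>carr L. act x a \<in> basis_elem ` verts F"
  let ?spans_path = "\<forall>x\<in>V - {0}. \<exists>k. \<exists>p\<in>paths (double_graph (hat_graph E w)).
    act x (nscale L k (path_monomial E w p)) \<in> basis_elem ` verts F"
  have simple_spans: "connected_graph F \<and> ?spans" if "simple_right_module L V act"
  proof -
    note reach = simple_reaches_all_vertices[OF that[unfolded L_def V_def act_def]]
    have "paths_between (double_graph F) u v \<noteq> {}" if "u \<in> verts F" "v \<in> verts F" for u v
    proof -
      have "(basis_elem u :: 'a \<Rightarrow>\<^sub>0 'k) \<noteq> 0" by (metis lookup_single_eq lookup_zero zero_neq_one)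
      then show ?thesis
        using reach[OF rep_module_basis[OF that(1)] _ that(2)] reachable_if_rep_act[OF that(1)] by blast
    qed
    moreover have ?spans
      unfolding L_def V_def act_def using reach assms(6) by (metis DiffE ex_in_conv image_eqI singletonI)
    ultimately show ?thesis unfolding connected_graph_def by blast
  qed
  have spans_simple: "simple_right_module L V act" if "connected_graph F \<and> ?spans"
    unfolding L_def V_def act_def
  proof (rule simple_if_connected_and_reaching)
    show "\<exists>a\<in>carr (wlpa E w). rep_act F \<phi>0 \<phi>1 x a \<in> basis_elem ` verts F"
      if "x \<in> rep_module F" "x \<noteq> 0" for x :: "'a \<Rightarrow>\<^sub>0 'k"
      using that \<open>connected_graph F \<and> ?spans\<close> unfolding L_def V_def act_def by simp
  qed (use that assms(6) in auto)
  have path_spans: ?spans if ?spans_path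
    using that path_monomial_carr unfolding L_def by blast
  have spans_irreducible: "irreducible_representation_graph E w F \<phi>0 \<phi>1"
    if connected: "connected_graph F" and spans: ?spans
    unfolding irreducible_representation_graph_def
  proof (intro conjI ballI impI notI)
    fix u v assume u: "u \<in> verts F" and v: "v \<in> verts F" and "u \<noteq> v"
      and same: "path_map \<phi>0 \<phi>1 ` paths_from (double_graph F) u =
                 path_map \<phi>0 \<phi>1 ` paths_from (double_graph F) v"
    let ?x = "basis_elem u - basis_elem v :: 'a \<Rightarrow>\<^sub>0 'k"
    have x: "?x \<in> rep_module F"
      using rep_module_add[OF rep_module_basis[OF u] rep_module_scale[OF rep_module_basis[OF v], of "-1"]]
      by (simp add: single_uminus)
    have "Poly_Mapping.lookup ?x u = 1"
      using \<open>u \<noteq> v\<close> by (simp add: lookup_minus lookup_single)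
    then have "?x \<noteq> 0" by (metis lookup_zero zero_neq_one)
    then obtain a z where a: "a \<in> carr L" "act ?x a = basis_elem z"
      using spans x unfolding V_def by blast
    obtain p where p: "p \<in> free_algebra (gens E w)" "a = wlpa_class E w p"
      using a(1) unfolding L_def by (rule wlpa_carrE)
    have "free_act F \<phi>0 \<phi>1 ?x p = basis_elem z"
      using a(2) unfolding act_def p(2) rep_act_class[OF x p(1)] .
    then show False using coeff_sum_same_paths[OF u v same, of p] by simp
  qed (use assms(5) connected in auto)
  have irreducible_path: "connected_graph F \<and> ?spans_path"
    if irr: "irreducible_representation_graph E w F \<phi>0 \<phi>1"
  proof (intro conjI ballI)
    show "connected_graph F" using irr unfolding irreducible_representation_graph_def by blast
    fix x assume "x \<in> V - {0}"
    then have x: "x \<in> rep_module F" "x \<noteq> 0" by (auto simp: V_def)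
    obtain gs v c where gs: "gs \<noteq> []" "v \<in> verts F" "c \<noteq> 0"
      "word_act F \<phi>0 \<phi>1 x gs = Poly_Mapping.single v c"
      by (rule irreducible_reaches_vertex[OF irr x])
    have "word_act F \<phi>0 \<phi>1 x gs \<noteq> 0"
      using gs(3,4) by (metis lookup_single_eq lookup_zero)
    then obtain p where p: "p \<in> paths (double_graph (hat_graph E w))"
      "word_act F \<phi>0 \<phi>1 x gs = word_act F \<phi>0 \<phi>1 x (path_word p)"
      by (rule word_acts_as_path[OF gs(1) x(1)])
    have "act x (nscale L (inverse c) (path_monomial E w p)) = basis_elem v"
      unfolding act_def L_def rep_act_path_monomial[OF x(1) p(1)] p(2)[symmetric] gs(4)
      using gs(3) by simp
    then show "\<exists>k. \<exists>p\<in>paths (double_graph (hat_graph E w)).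
        act x (nscale L k (path_monomial E w p)) \<in> basis_elem ` verts F"
      using p(1) gs(2) by blast
  qed
  show ?thesis
    using simple_spans spans_simple path_spans spans_irreducible irreducible_path by argo
qed

end
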